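(* Let $a\in L^1(I)$. The following identities between Green's functions hold for all $(t,s)\in I\times I$, each one whenever all the boundary value problems whose Green's functions appear in it are nonresonant: 1. $G_N[a,T](t,s)+G_D[a,T](t,s)=2\,G_P[\tilde a,2T](t,s)$ and $G_N[a,T](t,s)-G_D[a,T](t,s)=2\,G_P[\tilde a,2T](2T-t,s)$. 2. $G_{M_2}[a,T](t,s)+G_{M_1}[a,T](t,s)=2\,G_A[\tilde a,2T](t,s)$ and $G_{M_2}[a,T](t,s)-G_{M_1}[a,T](t,s)=2\,G_A[\tilde a,2T](2T-t,s)$. 3. $G_N[a,T](t,s)+G_{M_1}[a,T](t,s)=2\,G_N[\tilde a,2T](t,s)$ and $G_N[a,T](t,s)-G_{M_1}[a,T](t,s)=2\,G_N[\tilde a,2T](2T-t,s)$. 4. $G_{M_2}[a,T](t,s)+G_D[a,T](t,s)=2\,G_D[\tilde a,2T](t,s)$ and $G_{M_2}[a,T](t,s)-G_D[a,T](t,s)=2\,G_D[\tilde a,2T](2T-t,s)$. 5. $G_N[a,T](t,s)+G_D[a,T](t,s)+G_{M_1}[a,T](t,s)+G_{M_2}[a,T](t,s)=4\,G_P[\tilde{\tilde a},4T](t,s)$.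
   Context: Fix $T>0$ and put $I=[0,T]$. $W^{2,1}(c,d)$ is the set of $u\in C^1[c,d]$ with $u'$ absolutely continuous on $[c,d]$. For $a\in L^1(I)$, $\tilde a$ is its even extension to $[0,2T]$: $\tilde a(t)=a(t)$ on $[0,T]$, $\tilde a(t)=a(2T-t)$ on $(T,2T]$; and $\tilde{\tilde a}$ is the even extension of $\tilde a$ to $[0,4T]$: $\tilde{\tilde a}(t)=\tilde a(t)$ on $[0,2T]$, $\tilde{\tilde a}(t)=\tilde a(4T-t)$ on $(2T,4T]$. For $S>0$ and $q\in L^1(0,S)$ consider $u''(t)+q(t)u(t)=\sigma(t)$ for a.e. $t\in[0,S]$, $u\in W^{2,1}(0,S)$, with one of the boundary conditions: (P) periodic: $u(0)=u(S)$, $u'(0)=u'(S)$; (A) anti-periodic: $u(0)=-u(S)$, $u'(0)=-u'(S)$; (N) Neumann: $u'(0)=u'(S)=0$; (D) Dirichlet: $u(0)=u(S)=0$; ($M_1$) mixed: $u'(0)=u(S)=0$; ($M_2$) mixed: $u(0)=u'(S)=0$. The problem is nonresonant if for $\sigma=0$ it has only the trivial solution; then for every $\sigma\in L^1(0,S)$ it has a unique solution, given by $u(t)=\int_0^S G_B[q,S](t,s)\sigma(s)\,ds$ with $B\in\{P,A,N,D,M_1,M_2\}$, where $G_B[q,S]$ is the (unique, continuous on $[0,S]\times[0,S]$) Green's function. *)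

theory Defs
  imports "HOL-Analysis.Analysis"
begin

definition abs_cont_on :: "real \<Rightarrow> real \<Rightarrow> (real \<Rightarrow> real) \<Rightarrow> bool" where
  "abs_cont_on c d f \<longleftrightarrow>
     (\<forall>\<epsilon>>0. \<exists>\<delta>>0. \<forall>D.
        finite D \<and>
        (\<forall>(x, y)\<in>D. c \<le> x \<and> x \<le> y \<and> y \<le> d) \<and>
        pairwise (\<lambda>p p'. disjnt {fst p<..<snd p} {fst p'<..<snd p'}) D \<and>
        (\<Sum>(x, y)\<in>D. y - x) < \<delta>
        \<longrightarrow> (\<Sum>(x, y)\<in>D. \<bar>f y - f x\<bar>) < \<epsilon>)"

text \<open>The derivative relative to the closed interval, hence one-sided at the two end points.
  For \<open>c < d\<close> it depends only on the values of \<open>u\<close> on \<open>{c..d}\<close>.\<close>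

definition deriv_on :: "real \<Rightarrow> real \<Rightarrow> (real \<Rightarrow> real) \<Rightarrow> real \<Rightarrow> real" where
  "deriv_on c d u t = vector_derivative u (at t within {c..d})"

definition W21 :: "real \<Rightarrow> real \<Rightarrow> (real \<Rightarrow> real) set" where
  "W21 c d = {u. u differentiable_on {c..d} \<and> continuous_on {c..d} (deriv_on c d u) \<and>
                 abs_cont_on c d (deriv_on c d u)}"

definition even_ext :: "real \<Rightarrow> (real \<Rightarrow> real) \<Rightarrow> real \<Rightarrow> real" where
  "even_ext T a t = (if t \<le> T then a t else a (2 * T - t))"

datatype bdry = Periodic | Antiperiodic | Neumann | Dirichlet | Mixed1 | Mixed2

fun bdry_cond :: "bdry \<Rightarrow> real \<Rightarrow> (real \<Rightarrow> real) \<Rightarrow> bool" where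
  "bdry_cond Periodic S u \<longleftrightarrow> u 0 = u S \<and> deriv_on 0 S u 0 = deriv_on 0 S u S"
| "bdry_cond Antiperiodic S u \<longleftrightarrow> u 0 = - u S \<and> deriv_on 0 S u 0 = - deriv_on 0 S u S"
| "bdry_cond Neumann S u \<longleftrightarrow> deriv_on 0 S u 0 = 0 \<and> deriv_on 0 S u S = 0"
| "bdry_cond Dirichlet S u \<longleftrightarrow> u 0 = 0 \<and> u S = 0"
| "bdry_cond Mixed1 S u \<longleftrightarrow> deriv_on 0 S u 0 = 0 \<and> u S = 0"
| "bdry_cond Mixed2 S u \<longleftrightarrow> u 0 = 0 \<and> deriv_on 0 S u S = 0"

definition bvp_solution ::
  "bdry \<Rightarrow> (real \<Rightarrow> real) \<Rightarrow> real \<Rightarrow> (real \<Rightarrow> real) \<Rightarrow> (real \<Rightarrow> real) \<Rightarrow> bool" where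
  "bvp_solution B q S \<sigma> u \<longleftrightarrow>
     u \<in> W21 0 S \<and>
     (AE t in lebesgue_on {0..S}.
        \<exists>w. (deriv_on 0 S u has_real_derivative w) (at t within {0..S}) \<and> w + q t * u t = \<sigma> t) \<and>
     bdry_cond B S u"

definition nonresonant :: "bdry \<Rightarrow> (real \<Rightarrow> real) \<Rightarrow> real \<Rightarrow> bool" where
  "nonresonant B q S \<longleftrightarrow> (\<forall>u. bvp_solution B q S (\<lambda>_. 0) u \<longrightarrow> (\<forall>t\<in>{0..S}. u t = 0))"

definition is_green :: "bdry \<Rightarrow> (real \<Rightarrow> real) \<Rightarrow> real \<Rightarrow> (real \<Rightarrow> real \<Rightarrow> real) \<Rightarrow> bool" where
  "is_green B q S G \<longleftrightarrow>
     continuous_on ({0..S} \<times> {0..S}) (\<lambda>(t, s). G t s) \<and>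
     (\<forall>\<sigma>. \<sigma> absolutely_integrable_on {0..S} \<longrightarrow>
        bvp_solution B q S \<sigma> (\<lambda>t. LINT s:{0..S}|lebesgue. G t s * \<sigma> s))"

text \<open>The kernel is normalised to \<open>0\<close> outside the square, because only its values on the
  square are determined by the boundary value problem.\<close>

definition green :: "bdry \<Rightarrow> (real \<Rightarrow> real) \<Rightarrow> real \<Rightarrow> real \<Rightarrow> real \<Rightarrow> real" where
  "green B q S =
     (THE G. is_green B q S G \<and> (\<forall>t s. (t, s) \<notin> {0..S} \<times> {0..S} \<longrightarrow> G t s = 0))"

end

theory Submission
  imports Defs
begin

text \<open>
  Why the identities hold. Let \<open>u\<close> solve \<open>u'' + a u = \<sigma>\<close> on \<open>[0, T]\<close>, and extend \<open>u\<close> and \<open>\<sigma>\<close> to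
  \<open>[0, 2T]\<close> by reflection at \<open>T\<close> with a sign \<open>\<epsilon>\<close>. If \<open>u'(T) = 0\<close> the even extension, and if
  \<open>u(T) = 0\<close> the odd extension, is again a solution, now with the even extension of \<open>a\<close> as potential,
  and the boundary condition at \<open>0\<close> decides which of the conditions P, A, N, D it satisfies on
  \<open>[0, 2T]\<close> (lemmas \<open>hill_solution_refl_ext\<close> and \<open>reflects_to_table\<close>). Nonresonance of the problem
  on \<open>[0, 2T]\<close> says that its only solution is the one given by its Green's function \<open>H\<close>. Folding the
  integral over \<open>[0, 2T]\<close> back to \<open>[0, T]\<close> and varying \<open>\<sigma>\<close> gives, for the Green's function \<open>G\<close>
  of the small problem,
  \<open>G(t,s) = H(t,s) + \<epsilon> H(t,2T-s)\<close> and \<open>\<epsilon> G(t,s) = H(2T-t,s) + \<epsilon> H(2T-t,2T-s)\<close>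
  (lemma \<open>green_fold\<close>). Two small problems with opposite signs lead to the same \<open>H\<close>, and adding or
  subtracting their formulas gives the first four identities. Extending twice expresses each of the
  four functions in the last identity as \<open>H(t,s)\<close> plus three reflected terms with signs
  \<open>\<delta>\<close>, \<open>\<epsilon>\<close>, \<open>\<epsilon>\<delta>\<close>; over the four conditions each of these takes either value
  twice, so the reflected terms cancel in the sum (lemma \<open>green_quadruple\<close>).

  The argument needs the Green's functions to exist, and that is where most of the work lies, because
  \<open>a\<close> is only integrable. Solutions in \<open>W\<^sup>2\<^sup>,\<^sup>1\<close> are turned into a pair of integral equations
  (\<open>bvp_solution_iff\<close>), which uses both halves of the fundamental theorem of calculus for the
  Lebesgue integral: an absolutely continuous function is the integral of its almost everywhere
  derivative (\<open>abs_cont_on_has_integral\<close>), and an indefinite integral is absolutely continuous and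
  differentiable almost everywhere (\<open>primitive_on_abs_cont\<close>, \<open>primitive_on_ae_deriv\<close>). A fundamental
  system is found by a contraction in a weighted norm (\<open>hill_solution_exists\<close>), variation of
  constants gives a particular solution, and nonresonance makes the linear system for the boundary
  conditions regular (\<open>green_exists\<close>).
\<close>

section \<open>Absolutely continuous functions are integrals of their derivatives\<close>

lemma sum_lengths_le_measure:
  fixes D :: "(real \<times> real) set"
  assumes "finite D" and le: "\<And>x y. (x, y) \<in> D \<Longrightarrow> x \<le> y"
    and dj: "pairwise (\<lambda>p p'. disjnt {fst p<..<snd p} {fst p'<..<snd p'}) D"
    and sub: "\<And>x y. (x, y) \<in> D \<Longrightarrow> {x<..<y} \<subseteq> U" and U: "U \<in> lmeasurable"
  shows "(\<Sum>(x, y)\<in>D. y - x) \<le> measure lebesgue U"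
proof -
  have "(\<Sum>(x, y)\<in>D. y - x) = (\<Sum>p\<in>D. measure lebesgue {fst p<..<snd p})"
    by (rule sum.cong) (auto simp: le)
  also have "\<dots> = measure lebesgue (\<Union>p\<in>D. {fst p<..<snd p})"
    using assms(1) dj by (subst measure_UNION') (auto intro: bounded_set_imp_lmeasurable)
  also have "\<dots> \<le> measure lebesgue U"
  proof (rule measure_mono_fmeasurable[OF _ _ U])
    show "(\<Union>p\<in>D. {fst p<..<snd p}) \<subseteq> U" using sub by fastforce
  qed (use assms(1) in auto)
  finally show ?thesis .
qed

lemma sum_integrals_le_integral:
  fixes D :: "(real \<times> real) set" and r :: "real \<Rightarrow> real"
  assumes "finite D" and sub: "\<And>x y. (x, y) \<in> D \<Longrightarrow> {x..y} \<subseteq> {c..d}"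
    and dj: "pairwise (\<lambda>p p'. disjnt {fst p<..<snd p} {fst p'<..<snd p'}) D"
    and r: "r integrable_on {c..d}" and pos: "\<And>x. x \<in> {c..d} \<Longrightarrow> 0 \<le> r x"
  shows "(\<Sum>(x, y)\<in>D. integral {x..y} r) \<le> integral {c..d} r"
proof -
  define g where "g p x = (if x \<in> {fst p<..<snd p} then r x else 0)" for p :: "real \<times> real" and x
  have sub': "{fst p<..<snd p} \<subseteq> {c..d}" if "p \<in> D" for p
    using sub[of "fst p" "snd p"] that by (auto simp: subset_eq)
  have int: "r integrable_on {fst p<..<snd p}" if "p \<in> D" for p
    using sub[of "fst p" "snd p"] that integrable_subinterval_real[OF r, of "fst p" "snd p"]
    by (simp add: integrable_on_Icc_iff_Ioo)
  have *: "integral {c..d} (g p) = integral {fst p..snd p} r" "g p integrable_on {c..d}" if "p \<in> D" for p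
    using sub'[OF that] int[OF that] unfolding g_def
    by (auto simp only: integral_restrict_Int integrable_restrict_Int integral_open_interval_real Int_absorb2)
  have "(\<Sum>(x, y)\<in>D. integral {x..y} r) = (\<Sum>p\<in>D. integral {c..d} (g p))"
    by (rule sum.cong) (auto simp: *)
  also have "\<dots> = integral {c..d} (\<lambda>x. \<Sum>p\<in>D. g p x)"
    by (rule integral_sum[symmetric]) (auto simp: * assms(1))
  also have "\<dots> \<le> integral {c..d} r"
  proof (rule integral_le)
    show "(\<lambda>x. \<Sum>p\<in>D. g p x) integrable_on {c..d}"
      by (rule integrable_sum) (auto simp: * assms(1))
    show "(\<Sum>p\<in>D. g p x) \<le> r x" if x: "x \<in> {c..d}" for x
    proof (cases "\<exists>p\<in>D. x \<in> {fst p<..<snd p}")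
      case True
      then obtain p where p: "p \<in> D" "x \<in> {fst p<..<snd p}" by blast
      have "g p' x = 0" if "p' \<in> D - {p}" for p'
      proof -
        have "disjnt {fst p'<..<snd p'} {fst p<..<snd p}"
          using pairwiseD[OF dj, of p' p] p that by auto
        then show ?thesis using p by (auto simp: g_def disjnt_def)
      qed
      then have "(\<Sum>p\<in>D. g p x) = g p x"
        using assms(1) p by (simp add: sum.remove)
      then show ?thesis using p by (simp add: g_def)
    next
      case False
      then have "(\<Sum>p\<in>D. g p x) = 0" by (intro sum.neutral) (auto simp: g_def)
      then show ?thesis using pos[OF x] by simp
    qed
  qed (rule r)
  finally show ?thesis .
qed

text \<open>Vitali coverings are avoided by working with Henstock sums directly. At points where \<open>f\<close> is
  differentiable the gauge makes every term of the sum smaller than a multiple of the length of its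
  interval; at the exceptional points the gauge forces the intervals into an open set of small
  measure, where absolute continuity bounds the increments of \<open>f\<close>.\<close>

lemma abs_cont_on_has_integral:
  assumes ac: "abs_cont_on c d f" and "c \<le> d" and N: "negligible N"
    and der: "\<And>x. x \<in> {c..d} - N \<Longrightarrow> (f has_real_derivative h x) (at x within {c..d})"
  shows "(h has_integral f d - f c) {c..d}"
proof (cases "c = d")
  case True then show ?thesis using has_integral_refl(1)[of h d] by simp
next
  case False
  with \<open>c \<le> d\<close> have cd: "c < d" by simp
  define k where "k x = (if x \<in> N then 0 else h x)" for x
  have "(k has_integral f d - f c) {c..d}"
    unfolding has_integral_real
  proof (intro allI impI)
    fix e :: real assume e: "e > 0"
    define e' where "e' = e / (2 * (d - c))"
    have e': "e' > 0" using e cd by (simp add: e'_def)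
    from ac e obtain \<delta> where \<delta>: "\<delta> > 0" and ac\<delta>': "\<And>D. finite D \<and> (\<forall>(x, y)\<in>D. c \<le> x \<and> x \<le> y \<and> y \<le> d) \<and>
        pairwise (\<lambda>p p'. disjnt {fst p<..<snd p} {fst p'<..<snd p'}) D \<and>
        (\<Sum>(x, y)\<in>D. y - x) < \<delta> \<Longrightarrow> (\<Sum>(x, y)\<in>D. \<bar>f y - f x\<bar>) < e / 2"
      unfolding abs_cont_on_def using half_gt_zero[OF e] by blast
    have ac\<delta>: "(\<Sum>(x, y)\<in>D. \<bar>f y - f x\<bar>) < e / 2" if "finite D" "\<And>x y. (x,y) \<in> D \<Longrightarrow> c \<le> x \<and> x \<le> y \<and> y \<le> d"
        "pairwise (\<lambda>p p'. disjnt {fst p<..<snd p} {fst p'<..<snd p'}) D"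
        "(\<Sum>(x, y)\<in>D. y - x) < \<delta>" for D
      by (rule ac\<delta>') (use that in auto)
    have Ns: "N \<in> sets lebesgue" and N0: "emeasure lebesgue N = 0"
      using N by (auto simp: negligible_iff_null_sets null_sets_def)
    obtain U where U: "open U" "N \<subseteq> U" "U - N \<in> lmeasurable" "emeasure lebesgue (U - N) < ennreal \<delta>"
      using sets_lebesgue_outer_open[OF Ns \<delta>] by blast
    have Nl: "N \<in> lmeasurable" using N negligible_imp_measurable by blast
    have Ueq: "U = (U - N) \<union> N" using U by auto
    have Ul: "U \<in> lmeasurable" using U Nl fmeasurable.Un Ueq by metis
    have "emeasure lebesgue U \<le> emeasure lebesgue (U - N) + emeasure lebesgue N"
      using U Ns by (subst Ueq) (intro emeasure_subadditive; auto)
    with U(4) N0 have "emeasure lebesgue U < ennreal \<delta>" by simp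
    then have Um: "measure lebesgue U < \<delta>"
      using Ul \<delta> by (simp add: emeasure_eq_measure2 ennreal_less_iff)
    have "\<exists>r>0. \<forall>y\<in>{c..d}. \<bar>y - x\<bar> < r \<longrightarrow> \<bar>f y - f x - h x * (y - x)\<bar> \<le> e' * \<bar>y - x\<bar>" if "x \<in> {c..d} - N" for x
      using der[OF that] e' unfolding has_field_derivative_def has_derivative_within_alt
      by (auto simp: mult.commute)
    then obtain r where r: "\<And>x. x \<in> {c..d} - N \<Longrightarrow> r x > 0"
      and rd: "\<And>x y. x \<in> {c..d} - N \<Longrightarrow> y \<in> {c..d} \<Longrightarrow> \<bar>y - x\<bar> < r x \<Longrightarrow> \<bar>f y - f x - h x * (y - x)\<bar> \<le> e' * \<bar>y - x\<bar>"
      by metis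
    define \<gamma> where "\<gamma> x = (if x \<in> N then U else if x \<in> {c..d} then ball x (r x) else UNIV)" for x
    have "gauge \<gamma>" unfolding gauge_def \<gamma>_def using U r by auto
    moreover have "norm ((\<Sum>(x, K)\<in>p. Henstock_Kurzweil_Integration.content K *\<^sub>R k x) - (f d - f c)) < e"
      if p: "p tagged_division_of {c..d}" and fine: "\<gamma> fine p" for p
    proof -
      have fin: "finite p" using p by blast
      define w where "w = (\<lambda>(x::real, K::real set). Henstock_Kurzweil_Integration.content K *\<^sub>R k x - (f (Sup K) - f (Inf K)))"
      have K: "\<exists>u v. K = {u..v} \<and> u \<le> v \<and> c \<le> u \<and> v \<le> d \<and> x \<in> {u..v} \<and> {u..v} \<subseteq> \<gamma> x"
        if xK: "(x, K) \<in> p" for x K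
      proof -
        from tagged_division_ofD(4)[OF p xK] obtain u v where uv: "K = {u..v}" by auto
        have "x \<in> K" "K \<subseteq> {c..d}" using tagged_division_ofD(2,3)[OF p xK] by auto
        moreover have "K \<subseteq> \<gamma> x" using fine xK by (auto simp: fine_def)
        ultimately show ?thesis using uv by (intro exI[of _ u] exI[of _ v]) auto
      qed
      define pN where "pN = {q \<in> p. fst q \<in> N}"
      have finN: "finite pN" and pNp: "pN \<subseteq> p" using fin by (auto simp: pN_def)
      define J where "J q = (Inf (snd q), Sup (snd q))" for q :: "real \<times> real set"
      define D where "D = J ` pN"
      have disj: "disjnt {fst (J q)<..<snd (J q)} {fst (J q')<..<snd (J q')}" if qp: "q \<in> p" "q' \<in> p" "q \<noteq> q'" for q q'
      proof -
        obtain x K x' K' where q: "q = (x, K)" "q' = (x', K')" by (metis prod.collapse)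
        then have "interior K \<inter> interior K' = {}" using tagged_division_ofD(5)[OF p] qp by metis
        moreover obtain u v u' v' where "K = {u..v}" "u \<le> v" "K' = {u'..v'}" "u' \<le> v'"
          using K[of x K] K[of x' K'] qp q by blast
        ultimately show ?thesis using q by (auto simp: J_def disjnt_def interior_atLeastAtMost_real)
      qed
      \<comment> \<open>Distinct tags may share an interval only if it is degenerate, and then \<open>g\<close> vanishes on it.\<close>
      have sumJ: "(\<Sum>(x, y)\<in>D. g x y) = (\<Sum>q\<in>pN. g (Inf (snd q)) (Sup (snd q)))" if g: "\<And>x. g x x = 0" for g :: "real \<Rightarrow> real \<Rightarrow> real"
      proof -
        have "(\<Sum>(x, y)\<in>D. g x y) = (\<Sum>q\<in>pN. (\<lambda>(x, y). g x y) (J q))"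
          unfolding D_def
        proof (subst sum.reindex_nontrivial[OF finN])
          show "(case J q of (x, y) \<Rightarrow> g x y) = 0" if q: "q \<in> pN" "q' \<in> pN" "q \<noteq> q'" "J q = J q'" for q q'
          proof -
            have "disjnt {fst (J q)<..<snd (J q)} {fst (J q)<..<snd (J q)}"
              using disj[of q q'] q pNp by auto
            then have "snd (J q) \<le> fst (J q)" by (auto simp: disjnt_def)
            moreover obtain u v where "snd q = {u..v}" "u \<le> v"
              using K[of "fst q" "snd q"] q pNp by auto
            then have "fst (J q) \<le> snd (J q)" by (simp add: J_def)
            ultimately show ?thesis using g by (auto simp: split_beta)
          qed
        qed auto
        then show ?thesis by (simp add: J_def split_beta)
      qed
      have Dle: "c \<le> x \<and> x \<le> y \<and> y \<le> d \<and> {x<..<y} \<subseteq> U" if "(x, y) \<in> D" for x y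
      proof -
        from that obtain z Q where z: "(z, Q) \<in> pN" "(x, y) = J (z, Q)" by (auto simp: D_def)
        with K[of z Q] pNp obtain u v where "Q = {u..v}" "u \<le> v" "c \<le> u" "v \<le> d" "{u..v} \<subseteq> \<gamma> z" by blast
        with z show ?thesis by (auto simp: J_def \<gamma>_def pN_def)
      qed
      have Ddj: "pairwise (\<lambda>p p'. disjnt {fst p<..<snd p} {fst p'<..<snd p'}) D"
        unfolding D_def pairwise_def using disj pNp by blast
      have finD: "finite D" using finN by (simp add: D_def)
      have "(\<Sum>(x, y)\<in>D. y - x) \<le> measure lebesgue U"
        by (rule sum_lengths_le_measure[OF finD _ Ddj _ Ul]) (use Dle in blast)+
      then have "(\<Sum>(x, y)\<in>D. \<bar>f y - f x\<bar>) < e / 2"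
        by (intro ac\<delta> finD Ddj) (use Dle Um in auto)
      then have bN: "(\<Sum>q\<in>pN. \<bar>w q\<bar>) < e / 2"
        unfolding sumJ[of "\<lambda>x y. \<bar>f y - f x\<bar>", simplified]
        by (rule le_less_trans[rotated]) (auto intro!: sum_mono simp: w_def pN_def k_def split_beta)
      have wb: "\<bar>w q\<bar> \<le> e' * Henstock_Kurzweil_Integration.content (snd q)" if q: "q \<in> p - pN" for q
      proof -
        obtain x Q where xQ: "q = (x, Q)" by fastforce
        then obtain u v where uv: "Q = {u..v}" "u \<le> v" "c \<le> u" "v \<le> d" "x \<in> {u..v}" "{u..v} \<subseteq> \<gamma> x"
          using K[of x Q] q by blast
        have x: "x \<in> {c..d} - N" using uv q xQ by (auto simp: pN_def)
        then have "{u..v} \<subseteq> ball x (r x)" using uv by (auto simp: \<gamma>_def)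
        moreover have "u \<in> {u..v}" "v \<in> {u..v}" using uv by auto
        ultimately have "u \<in> ball x (r x)" "v \<in> ball x (r x)" by blast+
        then have "\<bar>u - x\<bar> < r x" "\<bar>v - x\<bar> < r x" by (auto simp: dist_real_def abs_minus_commute)
        then have "\<bar>f u - f x - h x * (u - x)\<bar> \<le> e' * \<bar>u - x\<bar>" "\<bar>f v - f x - h x * (v - x)\<bar> \<le> e' * \<bar>v - x\<bar>"
          by (auto intro!: rd[OF x] simp del: abs_of_nonneg abs_of_nonpos) (use uv in auto)
        moreover have "e' * \<bar>u - x\<bar> + e' * \<bar>v - x\<bar> = e' * (v - u)"
          using uv by (simp add: algebra_simps)
        moreover have "w q = (f u - f x - h x * (u - x)) - (f v - f x - h x * (v - x))"
          using uv x by (simp add: w_def xQ k_def algebra_simps)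
        ultimately show ?thesis using uv xQ by auto
      qed
      have "(\<Sum>q\<in>p - pN. \<bar>w q\<bar>) \<le> (\<Sum>q\<in>p. e' * Henstock_Kurzweil_Integration.content (snd q))"
        using fin e' by (intro order_trans[OF sum_mono[OF wb] sum_mono2]) auto
      also have "\<dots> = e' * (d - c)"
        using additive_content_tagged_division[of p c d] p cd
        by (simp add: sum_distrib_left[symmetric] split_beta)
      also have "\<dots> = e / 2" using cd unfolding e'_def by (simp add: field_simps)
      finally have b: "(\<Sum>q\<in>p - pN. \<bar>w q\<bar>) \<le> e / 2" .
      have "(\<Sum>(x, K)\<in>p. Henstock_Kurzweil_Integration.content K *\<^sub>R k x) - (f d - f c) = (\<Sum>q\<in>p. w q)"
        using additive_tagged_division_1[OF \<open>c \<le> d\<close> p, of f]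
        by (simp add: w_def split_beta sum_subtractf)
      also have "\<bar>\<dots>\<bar> \<le> (\<Sum>q\<in>p. \<bar>w q\<bar>)" by (rule sum_abs)
      also have "\<dots> = (\<Sum>q\<in>p - pN. \<bar>w q\<bar>) + (\<Sum>q\<in>pN. \<bar>w q\<bar>)"
        using pNp fin by (rule sum.subset_diff)
      also have "\<dots> < e" using b bN by simp
      finally show ?thesis by simp
    qed
    ultimately show "\<exists>\<gamma>. gauge \<gamma> \<and> (\<forall>p. p tagged_division_of {c..d} \<and> \<gamma> fine p \<longrightarrow>
        norm ((\<Sum>(x, K)\<in>p. Henstock_Kurzweil_Integration.content K *\<^sub>R k x) - (f d - f c)) < e)" by (intro exI[of _ \<gamma>] conjI allI impI) auto
  qed
  then show ?thesis
    by (rule has_integral_spike[OF N, rotated]) (auto simp: k_def)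
qed

section \<open>Indefinite integrals of integrable functions\<close>

lemma continuous_mult_absolutely_integrable:
  fixes f h :: "real \<Rightarrow> real"
  assumes "continuous_on {c..d} f" "h absolutely_integrable_on {c..d}"
  shows "(\<lambda>x. f x * h x) absolutely_integrable_on {c..d}"
proof (rule absolutely_integrable_bounded_measurable_product_real)
  show "f \<in> borel_measurable (lebesgue_on {c..d})"
    using assms by (intro continuous_imp_measurable_on_sets_lebesgue) auto
  show "bounded (f ` {c..d})"
    by (intro compact_imp_bounded compact_continuous_image assms) auto
qed (use assms in auto)

definition primitive_on :: "real \<Rightarrow> real \<Rightarrow> (real \<Rightarrow> real) \<Rightarrow> (real \<Rightarrow> real) \<Rightarrow> bool" where
  "primitive_on c d f h \<longleftrightarrow>
     h absolutely_integrable_on {c..d} \<and> (\<forall>t\<in>{c..d}. f t = f c + integral {c..t} h)"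

lemma primitive_on_absolutely_integrable: "primitive_on c d f h \<Longrightarrow> h absolutely_integrable_on {c..d}"
  by (simp add: primitive_on_def)

lemma primitive_on_eq: "primitive_on c d f h \<Longrightarrow> t \<in> {c..d} \<Longrightarrow> f t = f c + integral {c..t} h"
  unfolding primitive_on_def by blast

lemma primitive_on_diff:
  assumes p: "primitive_on c d f h" and xy: "c \<le> x" "x \<le> y" "y \<le> d"
  shows "h absolutely_integrable_on {x..y}" "f y - f x = integral {x..y} h"
proof -
  have h: "h absolutely_integrable_on {c..d}" by (rule primitive_on_absolutely_integrable[OF p])
  show "h absolutely_integrable_on {x..y}"
    by (rule absolutely_integrable_on_subinterval[OF h]) (use xy in auto)
  have "h absolutely_integrable_on {c..y}"
    by (rule absolutely_integrable_on_subinterval[OF h]) (use xy in auto)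
  then have "integral {c..x} h + integral {x..y} h = integral {c..y} h"
    using xy by (intro Henstock_Kurzweil_Integration.integral_combine) (auto simp: absolutely_integrable_on_def)
  moreover have "f y = f c + integral {c..y} h" "f x = f c + integral {c..x} h"
    using primitive_on_eq[OF p, of x] primitive_on_eq[OF p, of y] xy by auto
  ultimately show "f y - f x = integral {x..y} h" by simp
qed

lemma primitive_on_continuous:
  assumes "primitive_on c d f h" shows "continuous_on {c..d} f"
proof -
  have "continuous_on {c..d} (\<lambda>t. f c + integral {c..t} h)"
    using primitive_on_absolutely_integrable[OF assms]
    by (intro continuous_intros indefinite_integral_continuous_1) (simp add: absolutely_integrable_on_def)
  then show ?thesis
    by (rule continuous_on_eq) (rule primitive_on_eq[OF assms, symmetric])
qed

lemma primitive_on_deriv_continuous: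
  assumes p: "primitive_on c d f h" and h: "continuous_on {c..d} h" and t: "t \<in> {c..d}"
  shows "(f has_real_derivative h t) (at t within {c..d})"
proof -
  have "((\<lambda>t. f c + integral {c..t} h) has_real_derivative h t) (at t within {c..d})"
    using integral_has_real_derivative[OF h t] by (auto intro!: derivative_eq_intros)
  then show ?thesis
    by (rule has_field_derivative_transform_within[OF _ zero_less_one t])
      (rule primitive_on_eq[OF p, symmetric])
qed

text \<open>The part of an integrable function above a height \<open>n\<close> has small integral; below that height the
  integral over a set is at most \<open>n\<close> times the measure of the set. This split yields the absolute
  continuity of indefinite integrals.\<close>

lemma integral_truncation_tendsto_0:
  fixes h :: "real \<Rightarrow> real"
  assumes "h absolutely_integrable_on {c..d}"
  shows "(\<lambda>n. integral {c..d} (\<lambda>x. max (\<bar>h x\<bar> - real n) 0)) \<longlonglongrightarrow> 0"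
    "(\<lambda>x. max (\<bar>h x\<bar> - real n) 0) integrable_on {c..d}"
proof -
  have a: "(\<lambda>x. \<bar>h x\<bar>) absolutely_integrable_on {c..d}"
    using assms by (simp add: absolutely_integrable_on_def)
  have i: "(\<lambda>x. max (\<bar>h x\<bar> - real n) 0) absolutely_integrable_on {c..d}" for n
    by (intro absolutely_integrable_max_1 set_integral_diff a) auto
  then show "(\<lambda>x. max (\<bar>h x\<bar> - real n) 0) integrable_on {c..d}"
    by (simp add: absolutely_integrable_on_def)
  have "(\<lambda>n. integral {c..d} (\<lambda>x. max (\<bar>h x\<bar> - real n) 0)) \<longlonglongrightarrow> integral {c..d} (\<lambda>x. 0)"
  proof (rule dominated_convergence(2))
    show "(\<lambda>x. max (\<bar>h x\<bar> - real n) 0) integrable_on {c..d}" for n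
      using i by (simp add: absolutely_integrable_on_def)
    show "(\<lambda>x. \<bar>h x\<bar>) integrable_on {c..d}" using a by (simp add: absolutely_integrable_on_def)
    show "norm (max (\<bar>h x\<bar> - real n) 0) \<le> \<bar>h x\<bar>" for n x by auto
    show "(\<lambda>n. max (\<bar>h x\<bar> - real n) 0) \<longlonglongrightarrow> 0" for x
    proof (rule tendsto_eventually)
      obtain m where "\<bar>h x\<bar> \<le> real m" using real_arch_simple by blast
      then show "\<forall>\<^sub>F n in sequentially. max (\<bar>h x\<bar> - real n) 0 = 0"
        by (intro eventually_sequentiallyI[of m]) auto
    qed
  qed
  then show "(\<lambda>n. integral {c..d} (\<lambda>x. max (\<bar>h x\<bar> - real n) 0)) \<longlonglongrightarrow> 0" by simp
qed

lemma primitive_on_abs_cont: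
  assumes p: "primitive_on c d f h"
  shows "abs_cont_on c d f"
  unfolding abs_cont_on_def
proof (intro allI impI)
  fix e :: real assume e: "e > 0"
  have h: "h absolutely_integrable_on {c..d}" by (rule primitive_on_absolutely_integrable[OF p])
  define r where "r n = (\<lambda>x. max (\<bar>h x\<bar> - real n) 0)" for n
  have "\<forall>\<^sub>F n in sequentially. integral {c..d} (r n) < e / 2"
    using order_tendstoD(2)[OF integral_truncation_tendsto_0(1)[OF h], of "e / 2"] e by (simp add: r_def)
  then obtain n where n: "integral {c..d} (r n) < e / 2"
    by (auto simp: eventually_sequentially)
  have ri: "r n integrable_on {c..d}"
    using integral_truncation_tendsto_0(2)[OF h] by (simp add: r_def)
  define \<delta> where "\<delta> = e / (2 * (real n + 1))"
  have \<delta>: "\<delta> > 0" "real n * \<delta> \<le> e / 2" using e by (auto simp: \<delta>_def field_simps)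
  show "\<exists>\<delta>>0. \<forall>D. finite D \<and> (\<forall>(x, y)\<in>D. c \<le> x \<and> x \<le> y \<and> y \<le> d) \<and>
       pairwise (\<lambda>p p'. disjnt {fst p<..<snd p} {fst p'<..<snd p'}) D \<and>
       (\<Sum>(x, y)\<in>D. y - x) < \<delta> \<longrightarrow> (\<Sum>(x, y)\<in>D. \<bar>f y - f x\<bar>) < e"
  proof (intro exI conjI allI impI, rule \<delta>)
    fix D assume D: "finite D \<and> (\<forall>(x, y)\<in>D. c \<le> x \<and> x \<le> y \<and> y \<le> d) \<and>
       pairwise (\<lambda>p p'. disjnt {fst p<..<snd p} {fst p'<..<snd p'}) D \<and> (\<Sum>(x, y)\<in>D. y - x) < \<delta>"
    have b: "\<bar>f y - f x\<bar> \<le> real n * (y - x) + integral {x..y} (r n)" if "(x, y) \<in> D" for x y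
    proof -
      have xy: "c \<le> x" "x \<le> y" "y \<le> d" using D that by auto
      have hi: "h integrable_on {x..y}"
        using primitive_on_diff(1)[OF p xy] by (simp add: absolutely_integrable_on_def)
      have rxy: "r n integrable_on {x..y}"
        by (rule integrable_subinterval_real[OF ri]) (use xy in auto)
      have "\<bar>integral {x..y} h\<bar> \<le> integral {x..y} (\<lambda>s. real n + r n s)"
        by (rule Henstock_Kurzweil_Integration.integral_norm_bound_integral[of h, unfolded real_norm_def])
          (use hi rxy in \<open>auto intro!: integrable_add simp: r_def\<close>)
      also have "\<dots> = real n * (y - x) + integral {x..y} (r n)"
        using rxy xy by (subst Henstock_Kurzweil_Integration.integral_add) auto
      finally show ?thesis using primitive_on_diff(2)[OF p xy] by simp
    qed
    have "(\<Sum>(x, y)\<in>D. \<bar>f y - f x\<bar>) \<le> (\<Sum>(x, y)\<in>D. real n * (y - x) + integral {x..y} (r n))"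
      using b by (intro sum_mono) auto
    also have "\<dots> = real n * (\<Sum>(x, y)\<in>D. y - x) + (\<Sum>(x, y)\<in>D. integral {x..y} (r n))"
      by (simp add: sum.distrib split_beta sum_distrib_left)
    also have "\<dots> \<le> real n * \<delta> + integral {c..d} (r n)"
      using D ri by (intro add_mono mult_left_mono sum_integrals_le_integral) (auto simp: r_def)
    also have "\<dots> < e" using \<delta> n by simp
    finally show "(\<Sum>(x, y)\<in>D. \<bar>f y - f x\<bar>) < e" .
  qed
qed

text \<open>Lebesgue's differentiation theorem for intervals to the right of the point. The left derivative is
  obtained from it in \<open>primitive_on_ae_deriv\<close> by reflecting the line.\<close>

lemma ae_right_derivative_integral:
  fixes k :: "real \<Rightarrow> real"
  assumes "\<And>a b. k integrable_on {a..b}"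
  obtains N where "negligible N" "\<And>x e. \<lbrakk>x \<notin> N; 0 < e\<rbrakk> \<Longrightarrow>
     \<exists>\<delta>>0. \<forall>r. 0 < r \<and> r < \<delta> \<longrightarrow> \<bar>integral {x..x + r} k - k x * r\<bar> \<le> e * r"
proof -
  obtain N where N: "negligible N" and N2: "\<And>x e. \<lbrakk>x \<notin> N; 0 < e\<rbrakk> \<Longrightarrow> \<exists>d>0. \<forall>h. 0 < h \<and> h < d \<longrightarrow>
         norm (integral (cbox x (x + h *\<^sub>R One)) k /\<^sub>R h ^ DIM(real) - k x) < e"
    using integrable_ccontinuous_explicit[of k] assms by (auto simp: cbox_interval)
  have "\<exists>\<delta>>0. \<forall>r. 0 < r \<and> r < \<delta> \<longrightarrow> \<bar>integral {x..x + r} k - k x * r\<bar> \<le> e * r" if xe: "x \<notin> N" "0 < e" for x e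
  proof -
    obtain \<delta> where "\<delta> > 0" and \<delta>: "\<And>h. 0 < h \<Longrightarrow> h < \<delta> \<Longrightarrow> norm (integral (cbox x (x + h *\<^sub>R One)) k /\<^sub>R h ^ DIM(real) - k x) < e"
      using N2[OF xe] by blast
    have "\<bar>integral {x..x + r} k - k x * r\<bar> \<le> e * r" if r: "0 < r" "r < \<delta>" for r
    proof -
      have "\<bar>integral {x..x + r} k / r - k x\<bar> < e"
        using \<delta>[OF r] by (simp add: cbox_interval divide_inverse mult.commute)
      then have "\<bar>integral {x..x + r} k / r - k x\<bar> * r \<le> e * r"
        using r by (intro mult_right_mono) auto
      also have "\<bar>integral {x..x + r} k / r - k x\<bar> * r = \<bar>integral {x..x + r} k - k x * r\<bar>"
        using r by (simp add: abs_mult_pos left_diff_distrib)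
      finally show ?thesis .
    qed
    with \<open>\<delta> > 0\<close> show ?thesis by blast
  qed
  with N show ?thesis by (rule that)
qed

lemma primitive_on_ae_deriv:
  assumes p: "primitive_on c d f h"
  obtains N where "negligible N" "\<And>x. x \<in> {c..d} - N \<Longrightarrow> (f has_real_derivative h x) (at x within {c..d})"
proof -
  \<comment> \<open>The differentiation theorem is stated for functions that are integrable on every interval.\<close>
  define k where "k x = (if x \<in> {c..d} then h x else 0)" for x
  have hi: "h integrable_on {c..d}" using primitive_on_absolutely_integrable[OF p] by (simp add: absolutely_integrable_on_def)
  then have "k integrable_on UNIV"
    unfolding k_def by (simp only: Henstock_Kurzweil_Integration.integrable_restrict_UNIV)
  then have ki: "k integrable_on {a..b}" for a b using integrable_on_subinterval by blast
  have ki': "(\<lambda>x. k (- x)) integrable_on {a..b}" for a b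
    using ki[of "-b" "-a"] Henstock_Kurzweil_Integration.integrable_reflect_real[where f = k and a = "-b" and b = "-a"] by simp
  obtain N where N: "negligible N" and N2: "\<And>x e. \<lbrakk>x \<notin> N; 0 < e\<rbrakk> \<Longrightarrow>
     \<exists>\<delta>>0. \<forall>r. 0 < r \<and> r < \<delta> \<longrightarrow> \<bar>integral {x..x + r} k - k x * r\<bar> \<le> e * r"
    using ae_right_derivative_integral[OF ki] by blast
  obtain M where M: "negligible M" and M2: "\<And>x e. \<lbrakk>x \<notin> M; 0 < e\<rbrakk> \<Longrightarrow>
     \<exists>\<delta>>0. \<forall>r. 0 < r \<and> r < \<delta> \<longrightarrow> \<bar>integral {x..x + r} (\<lambda>x. k (- x)) - k (- x) * r\<bar> \<le> e * r"
    using ae_right_derivative_integral[OF ki'] by blast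
  define Z where "Z = N \<union> uminus ` M"
  have "negligible (uminus ` M)"
    by (rule negligible_differentiable_image_negligible[OF _ M]) (auto intro: derivative_intros simp: differentiable_on_def)
  then have Z: "negligible Z" using N by (simp add: Z_def negligible_Un)
  have "(f has_real_derivative h x) (at x within {c..d})" if x: "x \<in> {c..d} - Z" for x
    unfolding has_field_derivative_def has_derivative_within_alt
  proof (intro conjI allI impI)
    show "bounded_linear ((*) (h x))" by (rule bounded_linear_mult_right)
    fix e :: real assume e: "e > 0"
    have "x \<notin> N" "- x \<notin> M" using x unfolding Z_def by force+
    then obtain \<delta>1 \<delta>2 where \<delta>: "\<delta>1 > 0" "\<delta>2 > 0"
      and d1: "\<And>r. 0 < r \<Longrightarrow> r < \<delta>1 \<Longrightarrow> \<bar>integral {x..x + r} k - k x * r\<bar> \<le> e * r"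
      and d2: "\<And>r. 0 < r \<Longrightarrow> r < \<delta>2 \<Longrightarrow> \<bar>integral {-x..-x + r} (\<lambda>x. k (- x)) - k (- (-x)) * r\<bar> \<le> e * r"
      using N2[OF _ e] M2[OF _ e] by metis
    have kx: "k x = h x" using x by (simp add: k_def)
    have "norm (f y - f x - h x * (y - x)) \<le> e * norm (y - x)" if y: "y \<in> {c..d}" "norm (y - x) < min \<delta>1 \<delta>2" for y
    proof (cases y x rule: linorder_cases)
      case less
      have "f x - f y = integral {y..x} h" using primitive_on_diff(2)[OF p] less x y by auto
      also have "\<dots> = integral {y..x} k" by (rule integral_cong) (use x y in \<open>auto simp: k_def\<close>)
      also have "\<dots> = integral {-x..-y} (\<lambda>x. k (- x))" by simp
      finally have "\<bar>f x - f y - h x * (x - y)\<bar> \<le> e * (x - y)" using d2[of "x - y"] less y kx by simp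
      then show ?thesis using less by (simp add: abs_if algebra_simps split: if_splits)
    next
      case greater
      have "f y - f x = integral {x..y} h" using primitive_on_diff(2)[OF p] greater x y by auto
      also have "\<dots> = integral {x..y} k" by (rule integral_cong) (use x y in \<open>auto simp: k_def\<close>)
      finally show ?thesis using d1[of "y - x"] greater y kx by simp
    qed simp
    then show "\<exists>\<delta>>0. \<forall>y\<in>{c..d}. norm (y - x) < \<delta> \<longrightarrow> norm (f y - f x - h x * (y - x)) \<le> e * norm (y - x)"
      using \<delta> by (intro exI[of _ "min \<delta>1 \<delta>2"]) auto
  qed
  with Z show ?thesis by (rule that)
qed

lemma abs_cont_on_subset: "abs_cont_on c d f \<Longrightarrow> d' \<le> d \<Longrightarrow> abs_cont_on c d' f"
  unfolding abs_cont_on_def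
proof (intro allI impI)
  fix e :: real
  assume *: "\<forall>\<epsilon>>0. \<exists>\<delta>>0. \<forall>D. finite D \<and> (\<forall>(x, y)\<in>D. c \<le> x \<and> x \<le> y \<and> y \<le> d) \<and>
        pairwise (\<lambda>p p'. disjnt {fst p<..<snd p} {fst p'<..<snd p'}) D \<and>
        (\<Sum>(x, y)\<in>D. y - x) < \<delta> \<longrightarrow> (\<Sum>(x, y)\<in>D. \<bar>f y - f x\<bar>) < \<epsilon>" and d: "d' \<le> d" and "e > 0"
  then obtain \<delta> where "\<delta> > 0" and \<delta>: "\<And>D. finite D \<and> (\<forall>(x, y)\<in>D. c \<le> x \<and> x \<le> y \<and> y \<le> d) \<and>
        pairwise (\<lambda>p p'. disjnt {fst p<..<snd p} {fst p'<..<snd p'}) D \<and>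
        (\<Sum>(x, y)\<in>D. y - x) < \<delta> \<Longrightarrow> (\<Sum>(x, y)\<in>D. \<bar>f y - f x\<bar>) < e" by blast
  show "\<exists>\<delta>>0. \<forall>D. finite D \<and> (\<forall>(x, y)\<in>D. c \<le> x \<and> x \<le> y \<and> y \<le> d') \<and>
        pairwise (\<lambda>p p'. disjnt {fst p<..<snd p} {fst p'<..<snd p'}) D \<and>
        (\<Sum>(x, y)\<in>D. y - x) < \<delta> \<longrightarrow> (\<Sum>(x, y)\<in>D. \<bar>f y - f x\<bar>) < e"
    using \<open>\<delta> > 0\<close> d by (intro exI[of _ \<delta>] conjI allI impI \<delta>) fastforce+
qed

text \<open>One criterion for products and Lipschitz images of absolutely continuous functions, and for
  functions that agree on the interval.\<close>

lemma abs_cont_on_dominated: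
  assumes f: "abs_cont_on c d f" and g: "abs_cont_on c d g" and B: "B > 0"
    and le: "\<And>x y. \<lbrakk>c \<le> x; x \<le> y; y \<le> d\<rbrakk> \<Longrightarrow> \<bar>k y - k x\<bar> \<le> B * (\<bar>f y - f x\<bar> + \<bar>g y - g x\<bar>)"
  shows "abs_cont_on c d k"
  unfolding abs_cont_on_def
proof (intro allI impI)
  fix e :: real assume "e > 0"
  then have e: "e / (2 * B) > 0" using B by simp
  let ?ok = "\<lambda>\<delta> D. finite D \<and> (\<forall>(x, y)\<in>D. c \<le> x \<and> x \<le> y \<and> y \<le> d) \<and>
        pairwise (\<lambda>p p'. disjnt {fst p<..<snd p} {fst p'<..<snd p'}) D \<and> (\<Sum>(x, y)\<in>D. y - x) < \<delta>"
  obtain \<delta>1 where 1: "\<delta>1 > 0" "\<And>D. ?ok \<delta>1 D \<Longrightarrow> (\<Sum>(x, y)\<in>D. \<bar>f y - f x\<bar>) < e / (2 * B)"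
    using f[unfolded abs_cont_on_def, rule_format, OF e] by blast
  obtain \<delta>2 where 2: "\<delta>2 > 0" "\<And>D. ?ok \<delta>2 D \<Longrightarrow> (\<Sum>(x, y)\<in>D. \<bar>g y - g x\<bar>) < e / (2 * B)"
    using g[unfolded abs_cont_on_def, rule_format, OF e] by blast
  have "(\<Sum>(x, y)\<in>D. \<bar>k y - k x\<bar>) < e" if D: "?ok (min \<delta>1 \<delta>2) D" for D
  proof -
    have "(\<Sum>(x, y)\<in>D. \<bar>k y - k x\<bar>) \<le> (\<Sum>(x, y)\<in>D. B * (\<bar>f y - f x\<bar> + \<bar>g y - g x\<bar>))"
      using D le by (intro sum_mono) auto
    also have "\<dots> = B * ((\<Sum>(x, y)\<in>D. \<bar>f y - f x\<bar>) + (\<Sum>(x, y)\<in>D. \<bar>g y - g x\<bar>))"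
      by (simp add: sum.distrib split_beta sum_distrib_left distrib_left)
    also have "\<dots> < B * (e / (2 * B) + e / (2 * B))"
      using 1 2 D B by (intro mult_strict_left_mono add_strict_mono) auto
    also have "\<dots> = e" using B by simp
    finally show ?thesis .
  qed
  then show "\<exists>\<delta>>0. \<forall>D. ?ok \<delta> D \<longrightarrow> (\<Sum>(x, y)\<in>D. \<bar>k y - k x\<bar>) < e"
    using 1 2 by (intro exI[of _ "min \<delta>1 \<delta>2"]) auto
qed

lemma primitive_onI:
  assumes f: "abs_cont_on c d f" and h: "h absolutely_integrable_on {c..d}" and N: "negligible N"
    and der: "\<And>x. x \<in> {c..d} - N \<Longrightarrow> (f has_real_derivative h x) (at x within {c..d})"
  shows "primitive_on c d f h"
  unfolding primitive_on_def
proof (intro conjI ballI h)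
  fix t assume t: "t \<in> {c..d}"
  have "(h has_integral f t - f c) {c..t}"
  proof (rule abs_cont_on_has_integral[OF _ _ N])
    show "abs_cont_on c t f" using abs_cont_on_subset[OF f] t by auto
    show "(f has_real_derivative h x) (at x within {c..t})" if "x \<in> {c..t} - N" for x
      by (rule has_field_derivative_subset[OF der]) (use that t in auto)
  qed (use t in auto)
  then show "f t = f c + integral {c..t} h" by (simp add: integral_unique)
qed

section \<open>The boundary value problem as a pair of integral equations\<close>

lemma primitive_on_indef:
  assumes "h absolutely_integrable_on {c..d}"
  shows "primitive_on c d (\<lambda>t. z + integral {c..t} h) h"
  using assms by (simp add: primitive_on_def)

lemma primitive_on_add:
  assumes f: "primitive_on c d f h" and g: "primitive_on c d g k"
  shows "primitive_on c d (\<lambda>t. f t + g t) (\<lambda>t. h t + k t)"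
  unfolding primitive_on_def
proof (intro conjI ballI)
  show "(\<lambda>t. h t + k t) absolutely_integrable_on {c..d}"
    using f g by (intro set_integral_add primitive_on_absolutely_integrable)
  fix t assume t: "t \<in> {c..d}"
  then have "h integrable_on {c..t}" "k integrable_on {c..t}"
    using primitive_on_diff(1)[OF f, of c t] primitive_on_diff(1)[OF g, of c t]
    by (auto simp: absolutely_integrable_on_def)
  then show "f t + g t = f c + g c + integral {c..t} (\<lambda>t. h t + k t)"
    using primitive_on_eq[OF f t] primitive_on_eq[OF g t]
    by (simp add: Henstock_Kurzweil_Integration.integral_add)
qed

lemma primitive_on_cmult:
  assumes f: "primitive_on c d f h"
  shows "primitive_on c d (\<lambda>t. a * f t) (\<lambda>t. a * h t)"
  unfolding primitive_on_def
proof (intro conjI ballI)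
  show "(\<lambda>t. a * h t) absolutely_integrable_on {c..d}"
    using primitive_on_absolutely_integrable[OF f] by simp
  fix t assume "t \<in> {c..d}"
  then show "a * f t = a * f c + integral {c..t} (\<lambda>t. a * h t)"
    using primitive_on_eq[OF f, of t] by (simp add: distrib_left)
qed

lemma primitive_on_cong:
  assumes f: "primitive_on c d f h"
    and "\<And>t. t \<in> {c..d} \<Longrightarrow> f' t = f t" "\<And>t. t \<in> {c..d} \<Longrightarrow> h' t = h t"
  shows "primitive_on c d f' h'"
  unfolding primitive_on_def
proof (intro conjI ballI)
  show "h' absolutely_integrable_on {c..d}"
    using primitive_on_absolutely_integrable[OF f] assms(3) set_integrable_cong[of lebesgue lebesgue "{c..d}" "{c..d}" h' h] by simp
  fix t assume t: "t \<in> {c..d}"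
  have "integral {c..t} h' = integral {c..t} h"
    by (rule integral_cong) (use t assms(3) in auto)
  then show "f' t = f' c + integral {c..t} h'"
    using primitive_on_eq[OF f t] assms(2)[of c] assms(2)[of t] t by auto
qed

text \<open>Integration by parts. The product is absolutely continuous because both factors are bounded, and the
  product rule holds at almost every point.\<close>

lemma primitive_on_mult:
  assumes f: "primitive_on c d f h" and g: "primitive_on c d g k"
  shows "primitive_on c d (\<lambda>t. f t * g t) (\<lambda>t. f t * k t + g t * h t)"
proof -
  have cf: "continuous_on {c..d} f" and cg: "continuous_on {c..d} g"
    using f g by (auto intro: primitive_on_continuous)
  have "bounded (f ` {c..d})" "bounded (g ` {c..d})"
    by (auto intro!: compact_imp_bounded compact_continuous_image cf cg)
  then obtain A B where A: "\<forall>x\<in>{c..d}. \<bar>f x\<bar> \<le> A" and B: "\<forall>x\<in>{c..d}. \<bar>g x\<bar> \<le> B"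
    unfolding bounded_iff by auto
  define C where "C = \<bar>A\<bar> + \<bar>B\<bar> + 1"
  have ac: "abs_cont_on c d (\<lambda>t. f t * g t)"
  proof (rule abs_cont_on_dominated[OF primitive_on_abs_cont[OF f] primitive_on_abs_cont[OF g]])
    show "C > 0" by (simp add: C_def)
    fix x y assume xy: "c \<le> x" "x \<le> y" "y \<le> d"
    have "\<bar>f y * g y - f x * g x\<bar> = \<bar>(f y - f x) * g y + f x * (g y - g x)\<bar>"
      by (simp add: algebra_simps)
    also have "\<dots> \<le> \<bar>f y - f x\<bar> * \<bar>g y\<bar> + \<bar>f x\<bar> * \<bar>g y - g x\<bar>"
      by (metis abs_triangle_ineq abs_mult)
    also have "\<dots> \<le> \<bar>f y - f x\<bar> * C + C * \<bar>g y - g x\<bar>"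
      using bspec[OF A, of x] bspec[OF B, of y] xy by (intro add_mono mult_left_mono mult_right_mono) (auto simp: C_def)
    finally show "\<bar>f y * g y - f x * g x\<bar> \<le> C * (\<bar>f y - f x\<bar> + \<bar>g y - g x\<bar>)"
      by (simp add: algebra_simps)
  qed
  obtain N where N: "negligible N" "\<And>x. x \<in> {c..d} - N \<Longrightarrow> (f has_real_derivative h x) (at x within {c..d})"
    using primitive_on_ae_deriv[OF f] by blast
  obtain M where M: "negligible M" "\<And>x. x \<in> {c..d} - M \<Longrightarrow> (g has_real_derivative k x) (at x within {c..d})"
    using primitive_on_ae_deriv[OF g] by blast
  show ?thesis
  proof (rule primitive_onI[OF ac])
    show "(\<lambda>t. f t * k t + g t * h t) absolutely_integrable_on {c..d}"
      using cf cg f g by (intro set_integral_add continuous_mult_absolutely_integrable primitive_on_absolutely_integrable)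
    show "negligible (N \<union> M)" using N M by (simp add: negligible_Un)
    show "((\<lambda>t. f t * g t) has_real_derivative f x * k x + g x * h x) (at x within {c..d})"
      if "x \<in> {c..d} - (N \<union> M)" for x
      using N(2)[of x] M(2)[of x] that by (auto intro!: derivative_eq_intros)
  qed
qed

lemma primitive_on_zero:
  assumes "primitive_on c d f (\<lambda>_. 0)" "t \<in> {c..d}" shows "f t = f c"
  using primitive_on_eq[OF assms] by simp

text \<open>The boundary conditions in terms of the values \<open>u0\<close>, \<open>u1\<close> of the function and \<open>v0\<close>, \<open>v1\<close> of
  its derivative at the left and right end point, so that they can be discussed without
  differentiating a concrete function.\<close>

fun bdry_values :: "bdry \<Rightarrow> real \<Rightarrow> real \<Rightarrow> real \<Rightarrow> real \<Rightarrow> bool" where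
  "bdry_values Periodic u0 v0 u1 v1 \<longleftrightarrow> u0 = u1 \<and> v0 = v1"
| "bdry_values Antiperiodic u0 v0 u1 v1 \<longleftrightarrow> u0 = - u1 \<and> v0 = - v1"
| "bdry_values Neumann u0 v0 u1 v1 \<longleftrightarrow> v0 = 0 \<and> v1 = 0"
| "bdry_values Dirichlet u0 v0 u1 v1 \<longleftrightarrow> u0 = 0 \<and> u1 = 0"
| "bdry_values Mixed1 u0 v0 u1 v1 \<longleftrightarrow> v0 = 0 \<and> u1 = 0"
| "bdry_values Mixed2 u0 v0 u1 v1 \<longleftrightarrow> u0 = 0 \<and> v1 = 0"

lemma bdry_cond_iff: "bdry_cond B S u \<longleftrightarrow> bdry_values B (u 0) (deriv_on 0 S u 0) (u S) (deriv_on 0 S u S)"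
  by (cases B) auto

text \<open>The equation \<open>u'' + q u = \<sigma>\<close> as an integrated first order system for \<open>u\<close> and \<open>v = u'\<close>. In this
  form reflection, gluing at a point and linear combination are manipulations of integrals.\<close>

definition hill_solution :: "(real \<Rightarrow> real) \<Rightarrow> real \<Rightarrow> (real \<Rightarrow> real) \<Rightarrow> (real \<Rightarrow> real) \<Rightarrow> (real \<Rightarrow> real) \<Rightarrow> bool" where
  "hill_solution q S \<sigma> u v \<longleftrightarrow>
     primitive_on 0 S u v \<and> primitive_on 0 S v (\<lambda>t. \<sigma> t - q t * u t)"

lemma abs_cont_on_cong:
  assumes "abs_cont_on c d f" "\<And>t. t \<in> {c..d} \<Longrightarrow> g t = f t"
  shows "abs_cont_on c d g"
  by (rule abs_cont_on_dominated[OF assms(1) assms(1), of 1]) (use assms(2) in auto)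

text \<open>From left to right, \<open>v\<close> is the derivative of \<open>u\<close>, and \<open>abs_cont_on_has_integral\<close> recovers it from
  the equation, which holds only almost everywhere. Conversely \<open>u\<close> is the integral of a continuous
  function and hence differentiable at every point, end points included.\<close>

lemma bvp_solution_iff:
  assumes S: "S > 0" and q: "q absolutely_integrable_on {0..S}" and \<sigma>: "\<sigma> absolutely_integrable_on {0..S}"
  shows "bvp_solution B q S \<sigma> u \<longleftrightarrow> (\<exists>v. hill_solution q S \<sigma> u v \<and> bdry_values B (u 0) (v 0) (u S) (v S))"
proof
  assume bvp: "bvp_solution B q S \<sigma> u"
  define v where "v = deriv_on 0 S u"
  from bvp have diff: "u differentiable_on {0..S}" and cv: "continuous_on {0..S} v" and ac: "abs_cont_on 0 S v"
    and ae: "AE t in lebesgue_on {0..S}. \<exists>w. (v has_real_derivative w) (at t within {0..S}) \<and> w + q t * u t = \<sigma> t"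
    and bc: "bdry_cond B S u"
    by (auto simp: bvp_solution_def W21_def v_def)
  have der: "(u has_vector_derivative v t) (at t within {0..S})" if "t \<in> {0..S}" for t
    using diff that unfolding differentiable_on_def v_def deriv_on_def
    by (simp add: vector_derivative_works[symmetric])
  have u: "primitive_on 0 S u v"
    unfolding primitive_on_def
  proof (intro conjI ballI)
    show "v absolutely_integrable_on {0..S}" by (rule absolutely_integrable_continuous_real[OF cv])
    fix t assume t: "t \<in> {0..S}"
    have "(v has_integral u t - u 0) {0..t}"
      by (rule fundamental_theorem_of_calculus)
        (use t in \<open>auto intro!: has_vector_derivative_within_subset[OF der]\<close>)
    then show "u t = u 0 + integral {0..t} v" by (simp add: integral_unique)
  qed
  have cu: "continuous_on {0..S} u" by (rule primitive_on_continuous[OF u])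
  define N where "N = {t. \<not> (t \<in> {0..S} \<longrightarrow> (\<exists>w. (v has_real_derivative w) (at t within {0..S}) \<and> w + q t * u t = \<sigma> t))}"
  have N: "negligible N"
    using ae unfolding N_def
    by (subst (asm) AE_restrict_space_iff)
      (auto simp: eventually_ae_filter_negligible intro: negligible_subset)
  have "primitive_on 0 S v (\<lambda>t. \<sigma> t - q t * u t)"
  proof (rule primitive_onI[OF ac _ N])
    show "(\<lambda>t. \<sigma> t - q t * u t) absolutely_integrable_on {0..S}"
      using continuous_mult_absolutely_integrable[OF cu q] \<sigma> by (intro set_integral_diff) (auto simp: mult.commute)
    show "(v has_real_derivative \<sigma> t - q t * u t) (at t within {0..S})" if "t \<in> {0..S} - N" for t
    proof -
      from that obtain w where "(v has_real_derivative w) (at t within {0..S})" "w + q t * u t = \<sigma> t"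
        by (auto simp: N_def)
      moreover from this have "w = \<sigma> t - q t * u t" by simp
      ultimately show ?thesis by simp
    qed
  qed
  with u bc show "\<exists>v. hill_solution q S \<sigma> u v \<and> bdry_values B (u 0) (v 0) (u S) (v S)"
    unfolding hill_solution_def bdry_cond_iff v_def by blast
next
  assume "\<exists>v. hill_solution q S \<sigma> u v \<and> bdry_values B (u 0) (v 0) (u S) (v S)"
  then obtain v where u: "primitive_on 0 S u v" and v: "primitive_on 0 S v (\<lambda>t. \<sigma> t - q t * u t)"
    and bc: "bdry_values B (u 0) (v 0) (u S) (v S)" unfolding hill_solution_def by blast
  have cv: "continuous_on {0..S} v" by (rule primitive_on_continuous[OF v])
  have der: "(u has_vector_derivative v t) (at t within {0..S})" if "t \<in> {0..S}" for t
    using primitive_on_deriv_continuous[OF u cv that] by (simp add: has_real_derivative_iff_has_vector_derivative)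
  have veq: "deriv_on 0 S u t = v t" if "t \<in> {0..S}" for t
    unfolding deriv_on_def by (rule vector_derivative_within_closed_interval[OF S that der[OF that]])
  have "u differentiable_on {0..S}"
    unfolding differentiable_on_def using der differentiableI_vector by blast
  moreover have "continuous_on {0..S} (deriv_on 0 S u)"
    by (rule continuous_on_eq[OF cv]) (simp add: veq)
  moreover have "abs_cont_on 0 S (deriv_on 0 S u)"
    by (rule abs_cont_on_cong[OF primitive_on_abs_cont[OF v] veq])
  moreover obtain N where N: "negligible N" "\<And>t. t \<in> {0..S} - N \<Longrightarrow> (v has_real_derivative \<sigma> t - q t * u t) (at t within {0..S})"
    using primitive_on_ae_deriv[OF v] by blast
  have "AE t in lebesgue_on {0..S}. \<exists>w. (deriv_on 0 S u has_real_derivative w) (at t within {0..S}) \<and> w + q t * u t = \<sigma> t"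
  proof (subst AE_restrict_space_iff)
    show "AE t in lebesgue. t \<in> {0..S} \<longrightarrow> (\<exists>w. (deriv_on 0 S u has_real_derivative w) (at t within {0..S}) \<and> w + q t * u t = \<sigma> t)"
      unfolding eventually_ae_filter_negligible
    proof (intro exI[of _ N] conjI N(1), clarsimp)
      fix t assume t: "0 \<le> t" "t \<le> S"
        and *: "\<forall>w. (deriv_on 0 S u has_real_derivative w) (at t within {0..S}) \<longrightarrow> w + q t * u t \<noteq> \<sigma> t"
      show "t \<in> N"
      proof (rule ccontr)
        assume "t \<notin> N"
        then have "(v has_real_derivative \<sigma> t - q t * u t) (at t within {0..S})" using N(2) t by auto
        then have "(deriv_on 0 S u has_real_derivative \<sigma> t - q t * u t) (at t within {0..S})"
          by (rule has_field_derivative_transform_within[OF _ zero_less_one]) (use t veq in auto)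
        with * show False by force
      qed
    qed
  qed auto
  moreover have "bdry_cond B S u"
    using bc S veq[of 0] veq[of S] by (simp add: bdry_cond_iff)
  ultimately show "bvp_solution B q S \<sigma> u" by (simp add: bvp_solution_def W21_def)
qed

section \<open>Existence of solutions of the homogeneous equation\<close>

text \<open>With \<open>Q t\<close> the integral of \<open>\<bar>q\<bar>\<close> over \<open>[0, t]\<close>, the weight is \<open>E t = exp (L * Q t)\<close>, whose almost
  everywhere derivative is \<open>L * \<bar>q\<bar> * E\<close>. In the norm weighted by \<open>E\<close> the integral operator with kernel \<open>q\<close>
  therefore has norm at most \<open>1 / L\<close>, which makes Picard iteration contract on the whole interval
  at once.\<close>

lemma exponential_weight:
  fixes q :: "real \<Rightarrow> real"
  assumes q: "q absolutely_integrable_on {0..S}" and L: "L > 0"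
  obtains E where "continuous_on {0..S} E" "\<And>t. E t > 0" "\<And>r t. \<lbrakk>0 \<le> r; r \<le> t; t \<le> S\<rbrakk> \<Longrightarrow> E r \<le> E t"
    "\<And>t. t \<in> {0..S} \<Longrightarrow> integral {0..t} (\<lambda>s. \<bar>q s\<bar> * E s) \<le> E t / L"
    "(\<lambda>s. \<bar>q s\<bar> * E s) absolutely_integrable_on {0..S}"
proof -
  define Q where "Q t = integral {0..t} (\<lambda>s. \<bar>q s\<bar>)" for t
  have aq: "(\<lambda>s. \<bar>q s\<bar>) absolutely_integrable_on {0..S}"
    using q by (simp add: absolutely_integrable_on_def)
  have Q: "primitive_on 0 S Q (\<lambda>s. \<bar>q s\<bar>)"
    using primitive_on_indef[OF aq, of 0] by (simp add: Q_def[abs_def])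
  have mono: "Q r \<le> Q t" if "0 \<le> r" "r \<le> t" "t \<le> S" for r t
  proof -
    have "0 \<le> integral {r..t} (\<lambda>s. \<bar>q s\<bar>)"
      by (rule Henstock_Kurzweil_Integration.integral_nonneg)
        (use primitive_on_diff(1)[OF Q that] in \<open>auto simp: absolutely_integrable_on_def\<close>)
    then show ?thesis using primitive_on_diff(2)[OF Q that] by simp
  qed
  define E where "E t = exp (L * Q t)" for t
  have ac: "abs_cont_on 0 S E"
  proof (rule abs_cont_on_dominated[OF primitive_on_abs_cont[OF Q] primitive_on_abs_cont[OF Q]])
    show "L * exp (L * Q S) > 0" using L by simp
    fix x y assume xy: "0 \<le> x" "x \<le> y" "y \<le> S"
    have "E y - E x = exp (L * Q y) * (1 - exp (L * Q x - L * Q y))"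
      by (simp add: E_def algebra_simps exp_diff)
    also have "\<dots> \<le> exp (L * Q y) * (L * Q y - L * Q x)"
      using exp_ge_add_one_self[of "L * Q x - L * Q y"] by (intro mult_left_mono) (linarith, simp)
    also have "\<dots> \<le> exp (L * Q S) * (L * Q y - L * Q x)"
      using mono[OF xy] mono[of y S] xy L by (intro mult_right_mono) auto
    finally have "E y - E x \<le> L * exp (L * Q S) * (Q y - Q x)" by (simp add: algebra_simps)
    moreover have "E x \<le> E y" using mono[OF xy] L by (simp add: E_def)
    moreover have "0 \<le> L * exp (L * Q S) * (Q y - Q x)" using mono[OF xy] L by simp
    moreover have "L * exp (L * Q S) * (\<bar>Q y - Q x\<bar> + \<bar>Q y - Q x\<bar>) = 2 * (L * exp (L * Q S) * (Q y - Q x))"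
      using mono[OF xy] by simp
    ultimately show "\<bar>E y - E x\<bar> \<le> L * exp (L * Q S) * (\<bar>Q y - Q x\<bar> + \<bar>Q y - Q x\<bar>)"
      by linarith
  qed
  have cE: "continuous_on {0..S} E"
    unfolding E_def by (intro continuous_intros primitive_on_continuous[OF Q])
  have ai: "(\<lambda>s. \<bar>q s\<bar> * E s) absolutely_integrable_on {0..S}"
    using continuous_mult_absolutely_integrable[OF cE aq] by (simp add: mult.commute)
  obtain N where N: "negligible N" "\<And>x. x \<in> {0..S} - N \<Longrightarrow> (Q has_real_derivative \<bar>q x\<bar>) (at x within {0..S})"
    using primitive_on_ae_deriv[OF Q] by blast
  have E: "primitive_on 0 S E (\<lambda>s. L * (\<bar>q s\<bar> * E s))"
  proof (rule primitive_onI[OF ac _ N(1)])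
    show "(\<lambda>s. L * (\<bar>q s\<bar> * E s)) absolutely_integrable_on {0..S}" using ai by simp
    show "(E has_real_derivative L * (\<bar>q x\<bar> * E x)) (at x within {0..S})" if "x \<in> {0..S} - N" for x
      unfolding E_def by (auto intro!: derivative_eq_intros N(2)[OF that])
  qed
  show ?thesis
  proof (rule that[OF cE _ _ _ ai])
    show "E t > 0" for t by (simp add: E_def)
    show "E r \<le> E t" if "0 \<le> r" "r \<le> t" "t \<le> S" for r t
      using mono[OF that] L by (simp add: E_def)
    show "integral {0..t} (\<lambda>s. \<bar>q s\<bar> * E s) \<le> E t / L" if "t \<in> {0..S}" for t
    proof -
      have "E t = E 0 + L * integral {0..t} (\<lambda>s. \<bar>q s\<bar> * E s)"
        using primitive_on_eq[OF E that] by simp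
      moreover have "E 0 > 0" by (simp add: E_def)
      ultimately show ?thesis using L by (simp add: field_simps)
    qed
  qed
qed

lemma abs_integral_le_integral:
  fixes f g :: "real \<Rightarrow> real"
  assumes "f integrable_on X" "g integrable_on X" "\<And>x. x \<in> X \<Longrightarrow> \<bar>f x\<bar> \<le> g x"
  shows "\<bar>integral X f\<bar> \<le> integral X g"
  using Henstock_Kurzweil_Integration.integral_norm_bound_integral[of f X g] assms by simp

text \<open>The unknown of the fixed point equation is \<open>w = u / E\<close> for the weight \<open>E\<close> of \<open>exponential_weight\<close>
  with \<open>L = 2 * S\<close>; the two integrations then cost factors \<open>1 / (2 * S)\<close> and \<open>S\<close>, so the operator has
  contraction constant \<open>1 / 2\<close>. Functions on \<open>[0, S]\<close> are viewed as bounded continuous functions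
  on the line by clamping the argument.\<close>

lemma hill_solution_exists:
  assumes S: "S > 0" and q: "q absolutely_integrable_on {0..S}"
  obtains u v where "hill_solution q S (\<lambda>_. 0) u v" "u 0 = x0" "v 0 = y0"
proof -
  obtain E where cE: "continuous_on {0..S} E" and E0: "\<And>t. E t > 0"
    and Emono: "\<And>r t. \<lbrakk>0 \<le> r; r \<le> t; t \<le> S\<rbrakk> \<Longrightarrow> E r \<le> E t"
    and EL: "\<And>t. t \<in> {0..S} \<Longrightarrow> integral {0..t} (\<lambda>s. \<bar>q s\<bar> * E s) \<le> E t / (2 * S)"
    and Eai: "(\<lambda>s. \<bar>q s\<bar> * E s) absolutely_integrable_on {0..S}"
    using exponential_weight[OF q, of "2 * S"] S by auto
  define V where "V w t = y0 + integral {0..t} (\<lambda>s. - (E s * w s) * q s)" for w t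
  define U where "U w t = x0 + integral {0..t} (V w)" for w t
  have V: "primitive_on 0 S (V w) (\<lambda>s. - (E s * w s) * q s)" if "continuous_on {0..S} w" for w
    unfolding V_def[abs_def]
    by (intro primitive_on_indef continuous_mult_absolutely_integrable continuous_intros cE that q)
  have cV: "continuous_on {0..S} (V w)" if "continuous_on {0..S} w" for w
    by (rule primitive_on_continuous[OF V[OF that]])
  have U: "primitive_on 0 S (U w) (V w)" if "continuous_on {0..S} w" for w
    unfolding U_def[abs_def]
    by (intro primitive_on_indef absolutely_integrable_continuous_real cV that)
  have diffV: "\<bar>V w r - V w' r\<bar> \<le> b * (E r / (2 * S))"
    if w: "continuous_on {0..S} w" "continuous_on {0..S} w'" and r: "r \<in> {0..S}"
      and b: "\<And>s. s \<in> {0..S} \<Longrightarrow> \<bar>w s - w' s\<bar> \<le> b" for w w' r b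
  proof -
    have i: "(\<lambda>s. - (E s * w s) * q s) integrable_on {0..r}" "(\<lambda>s. - (E s * w' s) * q s) integrable_on {0..r}"
      using primitive_on_diff(1)[OF V, of _ 0 r] w r by (auto simp: absolutely_integrable_on_def)
    have ie: "(\<lambda>s. \<bar>q s\<bar> * E s) integrable_on {0..r}"
      using absolutely_integrable_on_subinterval[OF Eai, of 0 r] r by (auto simp: absolutely_integrable_on_def)
    have "V w r - V w' r = integral {0..r} (\<lambda>s. - (E s * w s) * q s - (- (E s * w' s) * q s))"
      using Henstock_Kurzweil_Integration.integral_diff[OF i] by (simp add: V_def)
    also have "\<bar>\<dots>\<bar> \<le> integral {0..r} (\<lambda>s. b * (\<bar>q s\<bar> * E s))"
    proof (rule abs_integral_le_integral)
      show "(\<lambda>s. - (E s * w s) * q s - (- (E s * w' s) * q s)) integrable_on {0..r}"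
        by (rule integrable_diff[OF i])
      show "(\<lambda>s. b * (\<bar>q s\<bar> * E s)) integrable_on {0..r}" using ie by (rule integrable_on_mult_right)
      fix s assume s: "s \<in> {0..r}"
      have "\<bar>- (E s * w s) * q s - (- (E s * w' s) * q s)\<bar> = \<bar>w s - w' s\<bar> * (\<bar>q s\<bar> * E s)"
      proof -
        have "- (E s * w s) * q s - (- (E s * w' s) * q s) = - ((w s - w' s) * (q s * E s))"
          by (simp add: algebra_simps)
        then show ?thesis using E0[of s] by (simp add: abs_mult)
      qed
      also have "\<dots> \<le> b * (\<bar>q s\<bar> * E s)"
        using b[of s] s r E0[of s] by (intro mult_right_mono) auto
      finally show "\<bar>- (E s * w s) * q s - (- (E s * w' s) * q s)\<bar> \<le> b * (\<bar>q s\<bar> * E s)" .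
    qed
    also have "\<dots> = b * integral {0..r} (\<lambda>s. \<bar>q s\<bar> * E s)" by simp
    also have "\<dots> \<le> b * (E r / (2 * S))"
      using EL[OF r] b[OF r] by (intro mult_left_mono) auto
    finally show ?thesis .
  qed
  have diffU: "\<bar>U w t - U w' t\<bar> \<le> (1/2) * b * E t"
    if w: "continuous_on {0..S} w" "continuous_on {0..S} w'" and t: "t \<in> {0..S}"
      and b: "\<And>s. s \<in> {0..S} \<Longrightarrow> \<bar>w s - w' s\<bar> \<le> b" for w w' t b
  proof -
    have b0: "b \<ge> 0" using b[OF t] by linarith
    have i: "V w integrable_on {0..t}" "V w' integrable_on {0..t}"
      using primitive_on_diff(1)[OF U, of _ 0 t] w t by (auto simp: absolutely_integrable_on_def)
    have "U w t - U w' t = integral {0..t} (\<lambda>s. V w s - V w' s)"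
      using Henstock_Kurzweil_Integration.integral_diff[OF i] by (simp add: U_def)
    also have "\<bar>\<dots>\<bar> \<le> integral {0..t} (\<lambda>s. b * (E t / (2 * S)))"
    proof (rule abs_integral_le_integral)
      show "(\<lambda>s. V w s - V w' s) integrable_on {0..t}" by (rule integrable_diff[OF i])
      fix s assume s: "s \<in> {0..t}"
      then have "\<bar>V w s - V w' s\<bar> \<le> b * (E s / (2 * S))" using diffV[OF w _ b] t by auto
      also have "\<dots> \<le> b * (E t / (2 * S))"
        using Emono[of s t] s t b0 S by (intro mult_left_mono divide_right_mono) auto
      finally show "\<bar>V w s - V w' s\<bar> \<le> b * (E t / (2 * S))" .
    qed auto
    also have "\<dots> = t * (b * (E t / (2 * S)))" using t by simp
    also have "\<dots> \<le> S * (b * (E t / (2 * S)))"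
      using t b0 E0[of t] S by (intro mult_right_mono) auto
    also have "\<dots> = (1/2) * b * E t" using S by simp
    finally show ?thesis .
  qed
  have "\<exists>g. \<forall>x. apply_bcontfun g x = U w (clamp 0 S x) / E (clamp 0 S x)" if w: "continuous_on {0..S} w" for w
  proof -
    have "continuous_on (cbox 0 S) (\<lambda>t. U w t / E t)"
      using cE primitive_on_continuous[OF U[OF w]] E0 by (auto intro!: continuous_on_divide simp: less_imp_neq[symmetric])
    then show ?thesis by (rule continuous_on_cbox_bcontfunE) (use that in auto)
  qed
  then have "\<forall>w. \<exists>g. \<forall>x. apply_bcontfun g x = U (apply_bcontfun w) (clamp 0 S x) / E (clamp 0 S x)"
    by (intro allI) simp
  from choice[OF this] obtain \<Psi> :: "(real \<Rightarrow>\<^sub>C real) \<Rightarrow> (real \<Rightarrow>\<^sub>C real)"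
    where \<Psi>: "\<And>w x. apply_bcontfun (\<Psi> w) x = U (apply_bcontfun w) (clamp 0 S x) / E (clamp 0 S x)"
    by blast
  have cl: "clamp 0 S x \<in> {0..S}" for x :: real
    using clamp_in_interval[of 0 S x] S by simp
  have "\<exists>!w. \<Psi> w = w"
  proof (rule banach_fix_type[of "1/2"])
    show "\<forall>w w'. dist (\<Psi> w) (\<Psi> w') \<le> 1 / 2 * dist w w'"
    proof (intro allI dist_bound)
      fix w w' :: "real \<Rightarrow>\<^sub>C real" and x :: real
      define t where "t = clamp 0 S x"
      have "\<bar>U w t - U w' t\<bar> \<le> (1/2) * dist w w' * E t"
        by (rule diffU) (use cl dist_bounded[of w _ w'] in \<open>auto simp: t_def dist_real_def\<close>)
      then have "\<bar>U w t - U w' t\<bar> / E t \<le> (1/2) * dist w w'"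
        using E0[of t] by (simp add: field_simps)
      moreover have "dist (\<Psi> w x) (\<Psi> w' x) = \<bar>U w t - U w' t\<bar> / E t"
        using E0[of t] by (simp add: \<Psi> t_def[symmetric] dist_real_def diff_divide_distrib[symmetric] abs_divide)
      ultimately show "dist (\<Psi> w x) (\<Psi> w' x) \<le> 1 / 2 * dist w w'" by simp
    qed
  qed auto
  then obtain w where w: "\<Psi> w = w" by blast
  have cw: "continuous_on {0..S} (apply_bcontfun w)" by simp
  have Uw: "U w t = E t * w t" if "t \<in> {0..S}" for t
  proof -
    have "clamp 0 S t = t" using that by simp
    then have "w t = U w t / E t" using \<Psi>[of w t] w by simp
    then show ?thesis using E0[of t] by (simp add: field_simps)
  qed
  have "primitive_on 0 S (V w) (\<lambda>t. 0 - q t * U w t)"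
    by (rule primitive_on_cong[OF V[OF cw]]) (simp_all add: Uw)
  then have "hill_solution q S (\<lambda>_. 0) (U w) (V w)"
    using U[OF cw] by (simp add: hill_solution_def)
  then show ?thesis by (rule that) (simp_all add: U_def V_def)
qed

section \<open>Green's functions: existence and uniqueness\<close>

lemma hill_solution_add:
  assumes "hill_solution q S \<sigma> u v" "hill_solution q S \<tau> w z"
  shows "hill_solution q S (\<lambda>t. \<sigma> t + \<tau> t) (\<lambda>t. u t + w t) (\<lambda>t. v t + z t)"
proof -
  have "primitive_on 0 S (\<lambda>t. v t + z t) (\<lambda>t. (\<sigma> t - q t * u t) + (\<tau> t - q t * w t))"
    using assms unfolding hill_solution_def by (intro primitive_on_add) auto
  then show ?thesis
    using assms unfolding hill_solution_def by (auto intro!: primitive_on_add simp: algebra_simps)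
qed

lemma hill_solution_cmult:
  assumes "hill_solution q S \<sigma> u v"
  shows "hill_solution q S (\<lambda>t. a * \<sigma> t) (\<lambda>t. a * u t) (\<lambda>t. a * v t)"
proof -
  have "primitive_on 0 S (\<lambda>t. a * v t) (\<lambda>t. a * (\<sigma> t - q t * u t))"
    using assms unfolding hill_solution_def by (intro primitive_on_cmult) auto
  then show ?thesis
    using assms unfolding hill_solution_def by (auto intro!: primitive_on_cmult simp: algebra_simps)
qed

lemma hill_solution_cong:
  assumes h: "hill_solution q S \<sigma> u v"
    and eq: "\<And>t. t \<in> {0..S} \<Longrightarrow> u' t = u t" "\<And>t. t \<in> {0..S} \<Longrightarrow> v' t = v t"
      "\<And>t. t \<in> {0..S} \<Longrightarrow> \<sigma>' t = \<sigma> t" "\<And>t. t \<in> {0..S} \<Longrightarrow> q' t = q t"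
  shows "hill_solution q' S \<sigma>' u' v'"
  unfolding hill_solution_def
  by (intro conjI primitive_on_cong[OF conjunct1[OF h[unfolded hill_solution_def]]]
      primitive_on_cong[OF conjunct2[OF h[unfolded hill_solution_def]]])
    (simp_all add: eq)

lemma hill_solution_zero:
  assumes h: "hill_solution q S \<sigma> u v" and S: "S > 0" and u0: "\<And>t. t \<in> {0..S} \<Longrightarrow> u t = 0" and t: "t \<in> {0..S}"
  shows "v t = 0"
proof -
  have u: "primitive_on 0 S u v" and cv: "continuous_on {0..S} v"
    using h primitive_on_continuous by (auto simp: hill_solution_def)
  have "(u has_real_derivative v t) (at t within {0..S})"
    by (rule primitive_on_deriv_continuous[OF u cv t])
  moreover have "(u has_real_derivative 0) (at t within {0..S})"
    by (rule has_field_derivative_transform_within[OF DERIV_const zero_less_one t]) (simp add: u0)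
  ultimately show ?thesis
    using vector_derivative_within_closed_interval[OF S t] by (metis has_real_derivative_iff_has_vector_derivative)
qed

lemma wronskian_constant:
  assumes 1: "hill_solution q S (\<lambda>_. 0) \<phi> \<phi>'" and 2: "hill_solution q S (\<lambda>_. 0) \<psi> \<psi>'" and t: "t \<in> {0..S}"
  shows "\<phi> t * \<psi>' t - \<psi> t * \<phi>' t = \<phi> 0 * \<psi>' 0 - \<psi> 0 * \<phi>' 0"
proof -
  have p: "primitive_on 0 S \<phi> \<phi>'" "primitive_on 0 S \<phi>' (\<lambda>t. 0 - q t * \<phi> t)"
    "primitive_on 0 S \<psi> \<psi>'" "primitive_on 0 S \<psi>' (\<lambda>t. 0 - q t * \<psi> t)"
    using 1 2 by (auto simp: hill_solution_def)
  have "primitive_on 0 S (\<lambda>t. \<phi> t * \<psi>' t - \<psi> t * \<phi>' t) (\<lambda>_. 0)"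
    by (rule primitive_on_cong[OF primitive_on_add[OF primitive_on_mult[OF p(1,4)]
            primitive_on_cmult[OF primitive_on_mult[OF p(3,2)], of "-1"]]])
      (auto simp: algebra_simps)
  from primitive_on_zero[OF this t] show ?thesis .
qed

text \<open>The derivatives of the two integrals drop out of \<open>u'\<close>, and in \<open>v'\<close> they combine to \<open>\<sigma>\<close> times the
  Wronskian, which is constant and equal to \<open>1\<close> at \<open>0\<close>.\<close>

lemma variation_of_constants:
  assumes 1: "hill_solution q S (\<lambda>_. 0) \<phi> \<phi>'" and 2: "hill_solution q S (\<lambda>_. 0) \<psi> \<psi>'"
    and init: "\<phi> 0 = 1" "\<phi>' 0 = 0" "\<psi> 0 = 0" "\<psi>' 0 = 1"
    and \<sigma>: "\<sigma> absolutely_integrable_on {0..S}"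
  shows "hill_solution q S \<sigma>
     (\<lambda>t. \<psi> t * integral {0..t} (\<lambda>s. \<phi> s * \<sigma> s) - \<phi> t * integral {0..t} (\<lambda>s. \<psi> s * \<sigma> s))
     (\<lambda>t. \<psi>' t * integral {0..t} (\<lambda>s. \<phi> s * \<sigma> s) - \<phi>' t * integral {0..t} (\<lambda>s. \<psi> s * \<sigma> s))"
proof -
  have p: "primitive_on 0 S \<phi> \<phi>'" "primitive_on 0 S \<phi>' (\<lambda>t. 0 - q t * \<phi> t)"
    "primitive_on 0 S \<psi> \<psi>'" "primitive_on 0 S \<psi>' (\<lambda>t. 0 - q t * \<psi> t)"
    using 1 2 by (auto simp: hill_solution_def)
  define A where "A t = integral {0..t} (\<lambda>s. \<phi> s * \<sigma> s)" for t
  define B where "B t = integral {0..t} (\<lambda>s. \<psi> s * \<sigma> s)" for t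
  have A: "primitive_on 0 S A (\<lambda>s. \<phi> s * \<sigma> s)"
    using primitive_on_indef[OF continuous_mult_absolutely_integrable[OF primitive_on_continuous[OF p(1)] \<sigma>], of 0]
    by (simp add: A_def[abs_def])
  have B: "primitive_on 0 S B (\<lambda>s. \<psi> s * \<sigma> s)"
    using primitive_on_indef[OF continuous_mult_absolutely_integrable[OF primitive_on_continuous[OF p(3)] \<sigma>], of 0]
    by (simp add: B_def[abs_def])
  have "primitive_on 0 S (\<lambda>t. \<psi> t * A t - \<phi> t * B t) (\<lambda>t. \<psi>' t * A t - \<phi>' t * B t)"
    by (rule primitive_on_cong[OF primitive_on_add[OF primitive_on_mult[OF p(3) A]
            primitive_on_cmult[OF primitive_on_mult[OF p(1) B], of "-1"]]])
      (auto simp: algebra_simps)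
  moreover have "primitive_on 0 S (\<lambda>t. \<psi>' t * A t - \<phi>' t * B t) (\<lambda>t. \<sigma> t - q t * (\<psi> t * A t - \<phi> t * B t))"
  proof (rule primitive_on_cong[OF primitive_on_add[OF primitive_on_mult[OF p(4) A]
            primitive_on_cmult[OF primitive_on_mult[OF p(2) B], of "-1"]]])
    fix t assume t: "t \<in> {0..S}"
    have W: "\<phi> t * \<psi>' t - \<psi> t * \<phi>' t = 1"
      using wronskian_constant[OF 1 2 t] init by simp
    have "\<psi>' t * (\<phi> t * \<sigma> t) + A t * (0 - q t * \<psi> t) + - 1 * (\<phi>' t * (\<psi> t * \<sigma> t) + B t * (0 - q t * \<phi> t))
       = \<sigma> t * (\<phi> t * \<psi>' t - \<psi> t * \<phi>' t) - q t * (\<psi> t * A t - \<phi> t * B t)"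
      by (simp add: algebra_simps)
    then show "\<sigma> t - q t * (\<psi> t * A t - \<phi> t * B t) =
       \<psi>' t * (\<phi> t * \<sigma> t) + A t * (0 - q t * \<psi> t) + - 1 * (\<phi>' t * (\<psi> t * \<sigma> t) + B t * (0 - q t * \<phi> t))"
      using W by simp
  qed simp
  ultimately show ?thesis by (simp add: hill_solution_def A_def B_def)
qed

text \<open>Every condition is given by two linear functionals of the four boundary values, which
  lets one construction of the Green's function serve all six.\<close>

lemma bdry_values_linear:
  obtains a1 b1 c1 d1 a2 b2 c2 d2 :: real where
    "\<And>u0 v0 u1 v1. bdry_values B u0 v0 u1 v1 \<longleftrightarrow>
       a1 * u0 + b1 * v0 + c1 * u1 + d1 * v1 = 0 \<and> a2 * u0 + b2 * v0 + c2 * u1 + d2 * v1 = 0"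
proof (cases B)
  case Periodic then show ?thesis using that[of 1 0 "-1" 0 0 1 0 "-1"] by simp
next
  case Antiperiodic then show ?thesis using that[of 1 0 1 0 0 1 0 1] by (simp add: eq_neg_iff_add_eq_0)
next
  case Neumann then show ?thesis using that[of 0 1 0 0 0 0 0 1] by simp
next
  case Dirichlet then show ?thesis using that[of 1 0 0 0 0 0 1 0] by simp
next
  case Mixed1 then show ?thesis using that[of 0 1 0 0 0 0 1 0] by simp
next
  case Mixed2 then show ?thesis using that[of 1 0 0 0 0 0 0 1] by simp
qed

lemma solve_2x2:
  fixes p1 p2 r1 r2 :: real
  assumes "p1 * r2 - p2 * r1 \<noteq> 0"
  obtains x y where "x * p1 + y * r1 = m" "x * p2 + y * r2 = n"
proof -
  let ?d = "p1 * r2 - p2 * r1"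
  have "(m * r2 - n * r1) / ?d * p1 + (n * p1 - m * p2) / ?d * r1 = m * ?d / ?d"
    unfolding times_divide_eq_left add_divide_distrib[symmetric] by (simp add: algebra_simps)
  moreover have "(m * r2 - n * r1) / ?d * p2 + (n * p1 - m * p2) / ?d * r2 = n * ?d / ?d"
    unfolding times_divide_eq_left add_divide_distrib[symmetric] by (simp add: algebra_simps)
  ultimately show ?thesis
    using assms by (intro that[of "(m * r2 - n * r1) / ?d" "(n * p1 - m * p2) / ?d"]) simp_all
qed

lemma kernel_2x2:
  fixes p1 p2 r1 r2 :: real
  assumes "p1 * r2 - p2 * r1 = 0"
  obtains x y where "x * p1 + y * r1 = 0" "x * p2 + y * r2 = 0" "x \<noteq> 0 \<or> y \<noteq> 0"
proof (cases "p1 = 0 \<and> r1 = 0")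
  case True
  show ?thesis
  proof (cases "p2 = 0 \<and> r2 = 0")
    case True then show ?thesis using that[of 1 1] \<open>p1 = 0 \<and> r1 = 0\<close> by simp
  next
    case False then show ?thesis using that[of r2 "- p2"] \<open>p1 = 0 \<and> r1 = 0\<close> by auto
  qed
next
  case False then show ?thesis using that[of r1 "- p1"] assms by (auto simp: algebra_simps)
qed

lemma set_lebesgue_integral_kernel:
  fixes k \<sigma> :: "real \<Rightarrow> real"
  assumes "continuous_on {0..S} k" "\<sigma> absolutely_integrable_on {0..S}"
  shows "(LINT s:{0..S}|lebesgue. k s * \<sigma> s) = integral {0..S} (\<lambda>s. k s * \<sigma> s)"
  by (rule set_lebesgue_integral_eq_integral(2)[OF continuous_mult_absolutely_integrable[OF assms]])

lemma is_green_continuous_section: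
  assumes "is_green B q S G" "t \<in> {0..S}"
  shows "continuous_on {0..S} (G t)"
proof -
  have c: "continuous_on ({0..S} \<times> {0..S}) (\<lambda>(t, s). G t s)" using assms by (simp add: is_green_def)
  have "continuous_on {0..S} ((\<lambda>(t, s). G t s) \<circ> (\<lambda>s. (t, s)))"
    by (intro continuous_on_compose continuous_intros continuous_on_subset[OF c]) (use assms in auto)
  then show ?thesis by (simp add: o_def)
qed

lemma is_green_solution:
  assumes S: "S > 0" and q: "q absolutely_integrable_on {0..S}" and G: "is_green B q S G"
    and \<sigma>: "\<sigma> absolutely_integrable_on {0..S}"
  obtains u v where "hill_solution q S \<sigma> u v" "bdry_values B (u 0) (v 0) (u S) (v S)"
    "\<And>t. t \<in> {0..S} \<Longrightarrow> u t = integral {0..S} (\<lambda>s. G t s * \<sigma> s)"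
proof -
  have "bvp_solution B q S \<sigma> (\<lambda>t. LINT s:{0..S}|lebesgue. G t s * \<sigma> s)"
    using G \<sigma> by (simp add: is_green_def)
  then obtain v where "hill_solution q S \<sigma> (\<lambda>t. LINT s:{0..S}|lebesgue. G t s * \<sigma> s) v"
    "bdry_values B (LINT s:{0..S}|lebesgue. G 0 s * \<sigma> s) (v 0) (LINT s:{0..S}|lebesgue. G S s * \<sigma> s) (v S)"
    unfolding bvp_solution_iff[OF S q \<sigma>] by blast
  then show ?thesis
    by (rule that) (rule set_lebesgue_integral_kernel[OF is_green_continuous_section[OF G] \<sigma>])
qed

lemma is_greenI:
  assumes S: "S > 0" and q: "q absolutely_integrable_on {0..S}"
    and c: "continuous_on ({0..S} \<times> {0..S}) (\<lambda>(t, s). G t s)"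
    and sol: "\<And>\<sigma>. \<sigma> absolutely_integrable_on {0..S} \<Longrightarrow> \<exists>u v. hill_solution q S \<sigma> u v \<and>
        bdry_values B (u 0) (v 0) (u S) (v S) \<and> (\<forall>t\<in>{0..S}. u t = integral {0..S} (\<lambda>s. G t s * \<sigma> s))"
  shows "is_green B q S G"
  unfolding is_green_def
proof (intro conjI c allI impI)
  fix \<sigma> :: "real \<Rightarrow> real" assume \<sigma>: "\<sigma> absolutely_integrable_on {0..S}"
  obtain u v where h: "hill_solution q S \<sigma> u v" and b: "bdry_values B (u 0) (v 0) (u S) (v S)"
    and u: "\<And>t. t \<in> {0..S} \<Longrightarrow> u t = integral {0..S} (\<lambda>s. G t s * \<sigma> s)"
    using sol[OF \<sigma>] by blast
  have "continuous_on {0..S} ((\<lambda>(t, s). G t s) \<circ> (\<lambda>s. (t, s)))" if "t \<in> {0..S}" for t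
    by (intro continuous_on_compose continuous_intros continuous_on_subset[OF c]) (use that in auto)
  then have cG: "continuous_on {0..S} (G t)" if "t \<in> {0..S}" for t
    using that by (simp add: o_def)
  have eq: "(LINT s:{0..S}|lebesgue. G t s * \<sigma> s) = u t" if "t \<in> {0..S}" for t
    using set_lebesgue_integral_kernel[OF cG[OF that] \<sigma>] u[OF that] by simp
  have "hill_solution q S \<sigma> (\<lambda>t. LINT s:{0..S}|lebesgue. G t s * \<sigma> s) v"
    by (rule hill_solution_cong[OF h eq]) auto
  moreover have "bdry_values B (LINT s:{0..S}|lebesgue. G 0 s * \<sigma> s) (v 0) (LINT s:{0..S}|lebesgue. G S s * \<sigma> s) (v S)"
    using b eq[of 0] eq[of S] S by simp
  ultimately show "bvp_solution B q S \<sigma> (\<lambda>t. LINT s:{0..S}|lebesgue. G t s * \<sigma> s)"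
    unfolding bvp_solution_iff[OF S q \<sigma>] by blast
qed

text \<open>In a fundamental system \<open>\<phi>\<close>, \<open>\<psi>\<close> the boundary conditions become a two by two linear system. A
  singular matrix would give a nontrivial solution of the homogeneous problem, so nonresonance makes
  it regular, and the solution formula of variation of constants can be corrected by a linear
  combination of \<open>\<phi>\<close> and \<open>\<psi>\<close>. Its coefficients are linear in the integrals of \<open>\<phi> \<sigma>\<close> and \<open>\<psi> \<sigma>\<close>, hence
  the correction is again given by a kernel.\<close>

lemma green_exists:
  assumes S: "S > 0" and q: "q absolutely_integrable_on {0..S}" and nr: "nonresonant B q S"
  obtains G where "is_green B q S G"
proof -
  obtain \<phi> \<phi>' where 1: "hill_solution q S (\<lambda>_. 0) \<phi> \<phi>'" and i1: "\<phi> 0 = 1" "\<phi>' 0 = 0"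
    using hill_solution_exists[OF S q] by blast
  obtain \<psi> \<psi>' where 2: "hill_solution q S (\<lambda>_. 0) \<psi> \<psi>'" and i2: "\<psi> 0 = 0" "\<psi>' 0 = 1"
    using hill_solution_exists[OF S q] by blast
  obtain a1 b1 c1 d1 a2 b2 c2 d2 where bv: "\<And>u0 v0 u1 v1. bdry_values B u0 v0 u1 v1 \<longleftrightarrow>
       a1 * u0 + b1 * v0 + c1 * u1 + d1 * v1 = 0 \<and> a2 * u0 + b2 * v0 + c2 * u1 + d2 * v1 = (0::real)"
    using bdry_values_linear by blast
  \<comment> \<open>Entries of the boundary system: rows are the two functionals, columns belong to \<open>\<phi>\<close> and \<open>\<psi>\<close>.\<close>
  define p1 where "p1 = a1 + c1 * \<phi> S + d1 * \<phi>' S"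
  define p2 where "p2 = a2 + c2 * \<phi> S + d2 * \<phi>' S"
  define r1 where "r1 = b1 + c1 * \<psi> S + d1 * \<psi>' S"
  define r2 where "r2 = b2 + c2 * \<psi> S + d2 * \<psi>' S"
  have comb: "hill_solution q S (\<lambda>_. 0) (\<lambda>t. x * \<phi> t + y * \<psi> t) (\<lambda>t. x * \<phi>' t + y * \<psi>' t)" for x y
    using hill_solution_add[OF hill_solution_cmult[OF 1, of x] hill_solution_cmult[OF 2, of y]] by simp
  have det: "p1 * r2 - p2 * r1 \<noteq> 0"
  proof
    assume "p1 * r2 - p2 * r1 = 0"
    then obtain x y where xy: "x * p1 + y * r1 = 0" "x * p2 + y * r2 = 0" "x \<noteq> 0 \<or> y \<noteq> 0"
      by (rule kernel_2x2)
    let ?u = "\<lambda>t. x * \<phi> t + y * \<psi> t" and ?v = "\<lambda>t. x * \<phi>' t + y * \<psi>' t"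
    have "bdry_values B (?u 0) (?v 0) (?u S) (?v S)"
      using xy(1,2) unfolding bv p1_def p2_def r1_def r2_def by (simp add: i1 i2 algebra_simps)
    with comb[of x y] have "bvp_solution B q S (\<lambda>_. 0) ?u"
      by (subst bvp_solution_iff[OF S q]) auto
    with nr have z: "?u t = 0" if "t \<in> {0..S}" for t using that unfolding nonresonant_def by blast
    have "x = 0" using z[of 0] S i1 i2 by simp
    moreover have "y = 0" using hill_solution_zero[OF comb S z, of 0] S i1 i2 by simp
    ultimately show False using xy(3) by simp
  qed
  \<comment> \<open>Corrections for the boundary values that the integrals of \<open>\<phi> \<sigma>\<close> and of \<open>\<psi> \<sigma>\<close> contribute at \<open>S\<close>.\<close>
  obtain x1 y1 where e1: "x1 * p1 + y1 * r1 = - (c1 * \<psi> S + d1 * \<psi>' S)" "x1 * p2 + y1 * r2 = - (c2 * \<psi> S + d2 * \<psi>' S)"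
    using solve_2x2[OF det] by blast
  obtain x2 y2 where e2: "x2 * p1 + y2 * r1 = c1 * \<phi> S + d1 * \<phi>' S" "x2 * p2 + y2 * r2 = c2 * \<phi> S + d2 * \<phi>' S"
    using solve_2x2[OF det] by blast
  \<comment> \<open>Taking the minimum makes the variation of constants kernel vanish for \<open>s \<ge> t\<close> and keeps it continuous.\<close>
  define K where "K t s = \<psi> t * \<phi> (min s t) - \<phi> t * \<psi> (min s t)" for t s
  define G where "G t s = K t s + \<phi> t * (x1 * \<phi> s + x2 * \<psi> s) + \<psi> t * (y1 * \<phi> s + y2 * \<psi> s)" for t s
  have c\<phi>: "continuous_on {0..S} \<phi>" and c\<psi>: "continuous_on {0..S} \<psi>"
    using 1 2 by (auto simp: hill_solution_def intro: primitive_on_continuous)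
  have "is_green B q S G"
  proof (rule is_greenI[OF S q])
    have 3: "continuous_on ({0..S} \<times> {0..S}) (\<lambda>p. f (fst p))" "continuous_on ({0..S} \<times> {0..S}) (\<lambda>p. f (snd p))"
      "continuous_on ({0..S} \<times> {0..S}) (\<lambda>p. f (min (snd p) (fst p)))" if "continuous_on {0..S} f" for f :: "real \<Rightarrow> real"
      by (rule continuous_on_compose2[OF that]; auto intro!: continuous_intros)+
    show "continuous_on ({0..S} \<times> {0..S}) (\<lambda>(t, s). G t s)"
      unfolding G_def K_def split_beta by (intro continuous_intros 3 c\<phi> c\<psi>)
    fix \<sigma> :: "real \<Rightarrow> real" assume \<sigma>: "\<sigma> absolutely_integrable_on {0..S}"
    define A where "A t = integral {0..t} (\<lambda>s. \<phi> s * \<sigma> s)" for t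
    define C where "C t = integral {0..t} (\<lambda>s. \<psi> s * \<sigma> s)" for t
    define X where "X = x1 * A S + x2 * C S"
    define Y where "Y = y1 * A S + y2 * C S"
    define u where "u t = \<psi> t * A t - \<phi> t * C t + (X * \<phi> t + Y * \<psi> t)" for t
    define v where "v t = \<psi>' t * A t - \<phi>' t * C t + (X * \<phi>' t + Y * \<psi>' t)" for t
    have i\<phi>: "(\<lambda>s. \<phi> s * \<sigma> s) absolutely_integrable_on {0..S}" and i\<psi>: "(\<lambda>s. \<psi> s * \<sigma> s) absolutely_integrable_on {0..S}"
      using c\<phi> c\<psi> \<sigma> by (auto intro: continuous_mult_absolutely_integrable)
    have it: "(\<lambda>s. \<phi> s * \<sigma> s) integrable_on {0..t}" "(\<lambda>s. \<psi> s * \<sigma> s) integrable_on {0..t}" if "t \<in> {0..S}" for t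
      using absolutely_integrable_on_subinterval[OF i\<phi>, of 0 t] absolutely_integrable_on_subinterval[OF i\<psi>, of 0 t] that
      by (auto simp: absolutely_integrable_on_def)
    have h: "hill_solution q S \<sigma> u v"
      using hill_solution_add[OF variation_of_constants[OF 1 2 i1 i2 \<sigma>] comb[of X Y]]
      by (simp add: u_def[abs_def] v_def[abs_def] A_def C_def)
    have AC0: "A 0 = 0" "C 0 = 0" by (simp_all add: A_def C_def)
    have "a1 * u 0 + b1 * v 0 + c1 * u S + d1 * v S =
       A S * (c1 * \<psi> S + d1 * \<psi>' S + (x1 * p1 + y1 * r1)) + C S * (- (c1 * \<phi> S + d1 * \<phi>' S) + (x2 * p1 + y2 * r1))"
      unfolding u_def v_def AC0 i1 i2 X_def Y_def p1_def r1_def by (simp add: algebra_simps)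
    moreover have "a2 * u 0 + b2 * v 0 + c2 * u S + d2 * v S =
       A S * (c2 * \<psi> S + d2 * \<psi>' S + (x1 * p2 + y1 * r2)) + C S * (- (c2 * \<phi> S + d2 * \<phi>' S) + (x2 * p2 + y2 * r2))"
      unfolding u_def v_def AC0 i1 i2 X_def Y_def p2_def r2_def by (simp add: algebra_simps)
    ultimately have b: "bdry_values B (u 0) (v 0) (u S) (v S)" unfolding bv e1 e2 by simp
    have "u t = integral {0..S} (\<lambda>s. G t s * \<sigma> s)" if t: "t \<in> {0..S}" for t
    proof -
      have "((\<lambda>s. \<psi> t * (\<phi> s * \<sigma> s) - \<phi> t * (\<psi> s * \<sigma> s)) has_integral (\<psi> t * A t - \<phi> t * C t)) {0..t}"
        unfolding A_def C_def by (intro has_integral_diff has_integral_mult_right integrable_integral it t)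
      then have K1: "((\<lambda>s. K t s * \<sigma> s) has_integral (\<psi> t * A t - \<phi> t * C t)) {0..t}"
        by (rule has_integral_eq[rotated]) (simp add: K_def algebra_simps min_def)
      have K2: "((\<lambda>s. K t s * \<sigma> s) has_integral 0) {t..S}"
        by (rule has_integral_eq[OF _ has_integral_0]) (simp add: K_def min_absorb2)
      have K: "((\<lambda>s. K t s * \<sigma> s) has_integral (\<psi> t * A t - \<phi> t * C t)) {0..S}"
        using has_integral_combine[OF _ _ K1 K2] t by simp
      have "((\<lambda>s. K t s * \<sigma> s + ((\<phi> t * x1 + \<psi> t * y1) * (\<phi> s * \<sigma> s) + (\<phi> t * x2 + \<psi> t * y2) * (\<psi> s * \<sigma> s)))
         has_integral (\<psi> t * A t - \<phi> t * C t) + ((\<phi> t * x1 + \<psi> t * y1) * A S + (\<phi> t * x2 + \<psi> t * y2) * C S)) {0..S}"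
        unfolding A_def[of S] C_def[of S] using S
        by (intro has_integral_add K has_integral_mult_right integrable_integral it) auto
      moreover have "(\<psi> t * A t - \<phi> t * C t) + ((\<phi> t * x1 + \<psi> t * y1) * A S + (\<phi> t * x2 + \<psi> t * y2) * C S) = u t"
        by (simp add: u_def X_def Y_def algebra_simps)
      ultimately have "((\<lambda>s. G t s * \<sigma> s) has_integral u t) {0..S}"
        by (simp add: G_def algebra_simps)
      then show ?thesis by (simp add: integral_unique)
    qed
    with h b show "\<exists>u v. hill_solution q S \<sigma> u v \<and>
        bdry_values B (u 0) (v 0) (u S) (v S) \<and> (\<forall>t\<in>{0..S}. u t = integral {0..S} (\<lambda>s. G t s * \<sigma> s))"
      by blast
  qed
  then show ?thesis by (rule that)
qed

lemma nonresonant_unique: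
  assumes S: "S > 0" and q: "q absolutely_integrable_on {0..S}" and nr: "nonresonant B q S"
    and 1: "hill_solution q S \<sigma> u v" "bdry_values B (u 0) (v 0) (u S) (v S)"
    and 2: "hill_solution q S \<sigma> w z" "bdry_values B (w 0) (z 0) (w S) (z S)"
    and t: "t \<in> {0..S}"
  shows "u t = w t"
proof -
  have "hill_solution q S (\<lambda>_. 0) (\<lambda>t. u t + - 1 * w t) (\<lambda>t. v t + - 1 * z t)"
    using hill_solution_add[OF 1(1) hill_solution_cmult[OF 2(1), of "-1"]] by simp
  moreover have "bdry_values B (u 0 + - 1 * w 0) (v 0 + - 1 * z 0) (u S + - 1 * w S) (v S + - 1 * z S)"
    using 1(2) 2(2) by (cases B) auto
  ultimately have "bvp_solution B q S (\<lambda>_. 0) (\<lambda>t. u t + - 1 * w t)"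
    by (subst bvp_solution_iff[OF S q]) auto
  with nr t have "u t + - 1 * w t = 0" unfolding nonresonant_def by blast
  then show ?thesis by simp
qed

text \<open>Testing with \<open>\<sigma> = k - l\<close> makes the integral of \<open>(k - l)\<^sup>2\<close> vanish.\<close>

lemma continuous_kernel_eqI:
  fixes k l :: "real \<Rightarrow> real"
  assumes S: "S > 0" and k: "continuous_on {0..S} k" and l: "continuous_on {0..S} l"
    and eq: "\<And>\<sigma>. \<sigma> absolutely_integrable_on {0..S} \<Longrightarrow>
        integral {0..S} (\<lambda>s. k s * \<sigma> s) = integral {0..S} (\<lambda>s. l s * \<sigma> s)"
    and s: "s \<in> {0..S}"
  shows "k s = l s"
proof -
  let ?\<sigma> = "\<lambda>s. k s - l s"
  have c: "continuous_on {0..S} ?\<sigma>" by (intro continuous_intros k l)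
  have \<sigma>: "?\<sigma> absolutely_integrable_on {0..S}" by (rule absolutely_integrable_continuous_real[OF c])
  have i: "(\<lambda>s. k s * ?\<sigma> s) integrable_on {0..S}" "(\<lambda>s. l s * ?\<sigma> s) integrable_on {0..S}"
    by (intro integrable_continuous_real continuous_intros k l)+
  have "integral {0..S} (\<lambda>s. ?\<sigma> s * ?\<sigma> s) = integral {0..S} (\<lambda>s. k s * ?\<sigma> s - l s * ?\<sigma> s)"
    by (simp add: algebra_simps)
  also have "\<dots> = 0" using Henstock_Kurzweil_Integration.integral_diff[OF i] eq[OF \<sigma>] by simp
  finally have "integral {0..S} (\<lambda>s. ?\<sigma> s * ?\<sigma> s) = 0" .
  then have "\<forall>s\<in>{0..S}. ?\<sigma> s * ?\<sigma> s = 0"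
    by (subst (asm) integral_eq_0_iff) (auto intro!: continuous_intros k l S)
  then show ?thesis using s by simp
qed

lemma is_green_unique:
  assumes S: "S > 0" and q: "q absolutely_integrable_on {0..S}" and nr: "nonresonant B q S"
    and G: "is_green B q S G" and H: "is_green B q S H" and ts: "t \<in> {0..S}" "s \<in> {0..S}"
  shows "G t s = H t s"
proof (rule continuous_kernel_eqI[OF S _ _ _ ts(2)])
  show "continuous_on {0..S} (G t)" "continuous_on {0..S} (H t)"
    using is_green_continuous_section G H ts by auto
  fix \<sigma> :: "real \<Rightarrow> real" assume \<sigma>: "\<sigma> absolutely_integrable_on {0..S}"
  obtain u v where 1: "hill_solution q S \<sigma> u v" "bdry_values B (u 0) (v 0) (u S) (v S)"
    "\<And>t. t \<in> {0..S} \<Longrightarrow> u t = integral {0..S} (\<lambda>s. G t s * \<sigma> s)"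
    using is_green_solution[OF S q G \<sigma>] by blast
  obtain w z where 2: "hill_solution q S \<sigma> w z" "bdry_values B (w 0) (z 0) (w S) (z S)"
    "\<And>t. t \<in> {0..S} \<Longrightarrow> w t = integral {0..S} (\<lambda>s. H t s * \<sigma> s)"
    using is_green_solution[OF S q H \<sigma>] by blast
  show "integral {0..S} (\<lambda>s. G t s * \<sigma> s) = integral {0..S} (\<lambda>s. H t s * \<sigma> s)"
    using nonresonant_unique[OF S q nr 1(1,2) 2(1,2) ts(1)] 1(3)[OF ts(1)] 2(3)[OF ts(1)] by simp
qed

text \<open>The normalisation outside the square makes the kernel unique as a function on the whole plane, so
  that the definite description denotes it.\<close>

lemma is_green_green:
  assumes S: "S > 0" and q: "q absolutely_integrable_on {0..S}" and nr: "nonresonant B q S"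
  shows "is_green B q S (green B q S)"
proof -
  obtain G where G: "is_green B q S G" using green_exists[OF S q nr] .
  define G0 where "G0 t s = (if (t, s) \<in> {0..S} \<times> {0..S} then G t s else 0)" for t s
  have G0: "is_green B q S G0"
  proof (rule is_greenI[OF S q])
    have "continuous_on ({0..S} \<times> {0..S}) (\<lambda>(t, s). G t s)" using G by (simp add: is_green_def)
    then show "continuous_on ({0..S} \<times> {0..S}) (\<lambda>(t, s). G0 t s)"
      by (rule continuous_on_eq) (auto simp: G0_def)
    fix \<sigma> :: "real \<Rightarrow> real" assume \<sigma>: "\<sigma> absolutely_integrable_on {0..S}"
    obtain u v where 1: "hill_solution q S \<sigma> u v" "bdry_values B (u 0) (v 0) (u S) (v S)"
      "\<And>t. t \<in> {0..S} \<Longrightarrow> u t = integral {0..S} (\<lambda>s. G t s * \<sigma> s)"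
      using is_green_solution[OF S q G \<sigma>] by blast
    have "integral {0..S} (\<lambda>s. G t s * \<sigma> s) = integral {0..S} (\<lambda>s. G0 t s * \<sigma> s)" if "t \<in> {0..S}" for t
      by (rule integral_cong) (use that in \<open>simp add: G0_def\<close>)
    with 1 show "\<exists>u v. hill_solution q S \<sigma> u v \<and> bdry_values B (u 0) (v 0) (u S) (v S) \<and>
        (\<forall>t\<in>{0..S}. u t = integral {0..S} (\<lambda>s. G0 t s * \<sigma> s))" by (intro exI[of _ u] exI[of _ v]) auto
  qed
  have "\<exists>!G. is_green B q S G \<and> (\<forall>t s. (t, s) \<notin> {0..S} \<times> {0..S} \<longrightarrow> G t s = 0)"
  proof (rule ex1I[of _ G0])
    show "is_green B q S G0 \<and> (\<forall>t s. (t, s) \<notin> {0..S} \<times> {0..S} \<longrightarrow> G0 t s = 0)"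
      using G0 by (simp add: G0_def)
    fix H assume H: "is_green B q S H \<and> (\<forall>t s. (t, s) \<notin> {0..S} \<times> {0..S} \<longrightarrow> H t s = 0)"
    show "H = G0"
    proof (intro ext)
      fix t s show "H t s = G0 t s"
        using H is_green_unique[OF S q nr _ G0, of H t s] by (cases "(t, s) \<in> {0..S} \<times> {0..S}") (auto simp: G0_def)
    qed
  qed
  from theI'[OF this] show ?thesis unfolding green_def by blast
qed

section \<open>Extension by reflection and the identities\<close>

definition refl_ext :: "real \<Rightarrow> real \<Rightarrow> (real \<Rightarrow> real) \<Rightarrow> real \<Rightarrow> real" where
  "refl_ext \<epsilon> T f t = (if t \<le> T then f t else \<epsilon> * f (2 * T - t))"

lemma even_ext_eq_refl_ext: "even_ext T f = refl_ext 1 T f"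
  by (simp add: fun_eq_iff even_ext_def refl_ext_def)

lemma has_integral_reflect_at:
  fixes h :: "real \<Rightarrow> real"
  assumes "(h has_integral i) {a..b}"
  shows "((\<lambda>s. h (c - s)) has_integral i) {c - b..c - a}"
proof -
  have "(\<lambda>x. c - x) ` {a..b} = {c - b..c - a}"
    by (auto intro!: image_eqI[of _ _ "c - _"])
  then show ?thesis
    using has_integral_affinity[of h i a b "-1" c] assms by (simp add: cbox_interval)
qed

lemma absolutely_integrable_reflect_at:
  fixes h :: "real \<Rightarrow> real"
  assumes "h absolutely_integrable_on {a..b}"
  shows "(\<lambda>s. h (c - s)) absolutely_integrable_on {c - b..c - a}"
  using assms has_integral_reflect_at[of h _ a b c] has_integral_reflect_at[of "\<lambda>s. norm (h s)" _ a b c]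
  unfolding absolutely_integrable_on_def integrable_on_def by blast

lemma primitive_on_reflect_at:
  assumes p: "primitive_on a b f h"
  shows "primitive_on (c - b) (c - a) (\<lambda>t. f (c - t)) (\<lambda>t. - h (c - t))"
  unfolding primitive_on_def
proof (intro conjI ballI)
  show "(\<lambda>t. - h (c - t)) absolutely_integrable_on {c - b..c - a}"
    using absolutely_integrable_reflect_at[OF primitive_on_absolutely_integrable[OF p], of c]
    by (simp add: absolutely_integrable_on_def integrable_neg_iff)
  fix t assume t: "t \<in> {c - b..c - a}"
  have d: "h absolutely_integrable_on {c - t..b}" "f b - f (c - t) = integral {c - t..b} h"
    using primitive_on_diff[OF p, of "c - t" b] t by auto
  then have "(h has_integral f b - f (c - t)) {c - t..b}"
    by (simp add: absolutely_integrable_on_def has_integral_iff)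
  from has_integral_reflect_at[OF this, of c] have "integral {c - b..t} (\<lambda>s. h (c - s)) = f b - f (c - t)"
    by (simp add: integral_unique)
  then show "f (c - t) = f (c - (c - b)) + integral {c - b..t} (\<lambda>s. - h (c - s))" by simp
qed

lemma primitive_on_join:
  assumes 1: "primitive_on a m f h" and 2: "primitive_on m b f h" and le: "a \<le> m" "m \<le> b"
  shows "primitive_on a b f h"
  unfolding primitive_on_def
proof (intro conjI ballI)
  show ai: "h absolutely_integrable_on {a..b}"
    using absolutely_integrable_on_combine[OF primitive_on_absolutely_integrable[OF 1] primitive_on_absolutely_integrable[OF 2] le] .
  fix t assume t: "t \<in> {a..b}"
  show "f t = f a + integral {a..t} h"
  proof (cases "t \<le> m")
    case True then show ?thesis using primitive_on_eq[OF 1, of t] t by auto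
  next
    case False
    have "h integrable_on {a..t}"
      using absolutely_integrable_on_subinterval[OF ai, of a t] t by (auto simp: absolutely_integrable_on_def)
    then have "integral {a..m} h + integral {m..t} h = integral {a..t} h"
      using False le by (intro Henstock_Kurzweil_Integration.integral_combine) auto
    then show ?thesis using primitive_on_eq[OF 1, of m] primitive_on_eq[OF 2, of t] False t le by auto
  qed
qed

text \<open>At the point of reflection \<open>refl_ext \<epsilon> T \<sigma>\<close> has the value \<open>\<sigma> T\<close>, whereas the reflected right half
  contributes \<open>\<epsilon> * \<sigma> T\<close> there; unlike \<open>u\<close> and \<open>v\<close>, the right hand side \<open>\<sigma>\<close> satisfies no matching
  condition.\<close>

lemma primitive_on_spike_point:
  assumes p: "primitive_on c d f h" and eq: "\<And>t. t \<in> {c..d} - {x} \<Longrightarrow> h' t = h t"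
  shows "primitive_on c d f h'"
  unfolding primitive_on_def
proof (intro conjI ballI)
  show "h' absolutely_integrable_on {c..d}"
    by (rule absolutely_integrable_spike[OF primitive_on_absolutely_integrable[OF p] negligible_sing eq])
  fix t assume t: "t \<in> {c..d}"
  have "integral {c..t} h' = integral {c..t} h"
    by (rule integral_spike[OF negligible_sing[of x]]) (use t eq in force)
  then show "f t = f c + integral {c..t} h'" using primitive_on_eq[OF p t] by simp
qed

lemma refl_ext_absolutely_integrable:
  assumes T: "T \<ge> 0" and \<sigma>: "\<sigma> absolutely_integrable_on {0..T}"
  shows "refl_ext \<epsilon> T \<sigma> absolutely_integrable_on {0..2 * T}"
proof (rule absolutely_integrable_on_combine[where c = T])
  show "refl_ext \<epsilon> T \<sigma> absolutely_integrable_on {0..T}"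
    by (rule absolutely_integrable_spike[OF \<sigma> negligible_empty]) (simp add: refl_ext_def)
  have "(\<lambda>s. \<epsilon> * \<sigma> (2 * T - s)) absolutely_integrable_on {T..2 * T}"
    using absolutely_integrable_reflect_at[OF \<sigma>, of "2 * T"] by simp
  then show "refl_ext \<epsilon> T \<sigma> absolutely_integrable_on {T..2 * T}"
    by (rule absolutely_integrable_spike[OF _ negligible_sing[of T]]) (auto simp: refl_ext_def)
qed (use T in auto)

text \<open>Substituting \<open>2 * T - s\<close> for \<open>s\<close> on the right half folds the integral onto \<open>[0, T]\<close>.\<close>

lemma integral_refl_ext:
  assumes T: "T \<ge> 0" and k: "continuous_on {0..2 * T} k" and \<sigma>: "\<sigma> absolutely_integrable_on {0..T}"
  shows "integral {0..2 * T} (\<lambda>s. k s * refl_ext \<epsilon> T \<sigma> s) = integral {0..T} (\<lambda>s. (k s + \<epsilon> * k (2 * T - s)) * \<sigma> s)"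
proof -
  have k1: "continuous_on {0..T} k" by (rule continuous_on_subset[OF k]) (use T in auto)
  have k2: "continuous_on {0..T} (\<lambda>s. k (2 * T - s))"
    by (rule continuous_on_compose2[OF k]) (use T in \<open>auto intro!: continuous_intros\<close>)
  have i1: "((\<lambda>s. k s * \<sigma> s) has_integral integral {0..T} (\<lambda>s. k s * \<sigma> s)) {0..T}"
    and i2: "((\<lambda>s. k (2 * T - s) * \<sigma> s) has_integral integral {0..T} (\<lambda>s. k (2 * T - s) * \<sigma> s)) {0..T}"
    using continuous_mult_absolutely_integrable[OF k1 \<sigma>] continuous_mult_absolutely_integrable[OF k2 \<sigma>]
    by (auto simp: absolutely_integrable_on_def)
  have "((\<lambda>s. k s * refl_ext \<epsilon> T \<sigma> s) has_integral integral {0..T} (\<lambda>s. k s * \<sigma> s)) {0..T}"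
    by (rule has_integral_eq[OF _ i1]) (simp add: refl_ext_def)
  moreover have "((\<lambda>s. k s * refl_ext \<epsilon> T \<sigma> s) has_integral \<epsilon> * integral {0..T} (\<lambda>s. k (2 * T - s) * \<sigma> s)) {T..2 * T}"
  proof (rule has_integral_spike[OF negligible_sing[of T]])
    show "((\<lambda>s. \<epsilon> * (k s * \<sigma> (2 * T - s))) has_integral \<epsilon> * integral {0..T} (\<lambda>s. k (2 * T - s) * \<sigma> s)) {T..2 * T}"
      using has_integral_mult_right[OF has_integral_reflect_at[OF i2, of "2 * T"], of \<epsilon>] by simp
  qed (auto simp: refl_ext_def)
  ultimately have "((\<lambda>s. k s * refl_ext \<epsilon> T \<sigma> s) has_integral
      integral {0..T} (\<lambda>s. k s * \<sigma> s) + \<epsilon> * integral {0..T} (\<lambda>s. k (2 * T - s) * \<sigma> s)) {0..2 * T}"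
    using has_integral_combine[of 0 T "2 * T"] T by simp
  moreover have "((\<lambda>s. (k s + \<epsilon> * k (2 * T - s)) * \<sigma> s) has_integral
      integral {0..T} (\<lambda>s. k s * \<sigma> s) + \<epsilon> * integral {0..T} (\<lambda>s. k (2 * T - s) * \<sigma> s)) {0..T}"
    using has_integral_add[OF i1 has_integral_mult_right[OF i2, of \<epsilon>]] by (simp add: algebra_simps)
  ultimately show ?thesis by (simp add: integral_unique)
qed

text \<open>The first two equations state that the extensions of \<open>u\<close> with sign \<open>\<epsilon>\<close> and of \<open>u'\<close> with sign
  \<open>-\<epsilon>\<close> match at the point of reflection: for \<open>\<epsilon> = 1\<close> they mean \<open>u'(T) = 0\<close>, for \<open>\<epsilon> = -1\<close> they mean
  \<open>u(T) = 0\<close>. The last conjunct is the condition that the extension satisfies on the doubled interval,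
  where its values at the right end are \<open>\<epsilon> * u0\<close> and \<open>-\<epsilon> * v0\<close>.\<close>

definition reflects_to :: "bdry \<Rightarrow> real \<Rightarrow> bdry \<Rightarrow> bool" where
  "reflects_to B \<epsilon> B' \<longleftrightarrow> (\<forall>u0 v0 u1 v1. bdry_values B u0 v0 u1 v1 \<longrightarrow>
     u1 = \<epsilon> * u1 \<and> v1 = - \<epsilon> * v1 \<and> bdry_values B' u0 v0 (\<epsilon> * u0) (- \<epsilon> * v0))"

lemma reflects_to_table:
  "reflects_to Neumann 1 Periodic" "reflects_to Dirichlet (-1) Periodic"
  "reflects_to Mixed2 1 Antiperiodic" "reflects_to Mixed1 (-1) Antiperiodic"
  "reflects_to Neumann 1 Neumann" "reflects_to Mixed1 (-1) Neumann"
  "reflects_to Mixed2 1 Dirichlet" "reflects_to Dirichlet (-1) Dirichlet"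
  by (simp_all add: reflects_to_def)

text \<open>Reflection preserves the equation on each half, and the matching condition in \<open>reflects_to\<close> lets the
  two halves be glued.\<close>

lemma hill_solution_refl_ext:
  assumes T: "T > 0" and h: "hill_solution q T \<sigma> u v" and b: "bdry_values B (u 0) (v 0) (u T) (v T)"
    and r: "reflects_to B \<epsilon> B'"
  shows "hill_solution (even_ext T q) (2 * T) (refl_ext \<epsilon> T \<sigma>) (refl_ext \<epsilon> T u) (refl_ext (- \<epsilon>) T v)"
    and "bdry_values B' (refl_ext \<epsilon> T u 0) (refl_ext (- \<epsilon>) T v 0) (refl_ext \<epsilon> T u (2 * T)) (refl_ext (- \<epsilon>) T v (2 * T))"
proof -
  have m: "\<epsilon> * u T = u T" "- \<epsilon> * v T = v T" and b': "bdry_values B' (u 0) (v 0) (\<epsilon> * u 0) (- \<epsilon> * v 0)"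
    using r[unfolded reflects_to_def, rule_format, OF b] by auto
  show "bdry_values B' (refl_ext \<epsilon> T u 0) (refl_ext (- \<epsilon>) T v 0) (refl_ext \<epsilon> T u (2 * T)) (refl_ext (- \<epsilon>) T v (2 * T))"
    using b' T by (simp add: refl_ext_def)
  have u: "primitive_on 0 T u v" and v: "primitive_on 0 T v (\<lambda>t. \<sigma> t - q t * u t)"
    using h by (auto simp: hill_solution_def)
  have right: "refl_ext \<epsilon> T u t = \<epsilon> * u (2 * T - t)" "refl_ext (- \<epsilon>) T v t = - \<epsilon> * v (2 * T - t)" if "t \<in> {T..2 * T}" for t
    using that m by (auto simp: refl_ext_def)
  have ru: "primitive_on T (2 * T) (\<lambda>t. u (2 * T - t)) (\<lambda>t. - v (2 * T - t))"
    using primitive_on_reflect_at[OF u, of "2 * T"] by simp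
  have rv: "primitive_on T (2 * T) (\<lambda>t. v (2 * T - t)) (\<lambda>t. - (\<sigma> (2 * T - t) - q (2 * T - t) * u (2 * T - t)))"
    using primitive_on_reflect_at[OF v, of "2 * T"] by simp
  have "primitive_on 0 (2 * T) (refl_ext \<epsilon> T u) (refl_ext (- \<epsilon>) T v)"
  proof (rule primitive_on_join[of _ T])
    show "primitive_on 0 T (refl_ext \<epsilon> T u) (refl_ext (- \<epsilon>) T v)"
      by (rule primitive_on_cong[OF u]) (auto simp: refl_ext_def)
    show "primitive_on T (2 * T) (refl_ext \<epsilon> T u) (refl_ext (- \<epsilon>) T v)"
      by (rule primitive_on_cong[OF primitive_on_cmult[OF ru, of \<epsilon>]]) (simp_all add: right)
  qed (use T in auto)
  moreover have "primitive_on 0 (2 * T) (refl_ext (- \<epsilon>) T v) (\<lambda>t. refl_ext \<epsilon> T \<sigma> t - even_ext T q t * refl_ext \<epsilon> T u t)"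
  proof (rule primitive_on_join[of _ T])
    show "primitive_on 0 T (refl_ext (- \<epsilon>) T v) (\<lambda>t. refl_ext \<epsilon> T \<sigma> t - even_ext T q t * refl_ext \<epsilon> T u t)"
      by (rule primitive_on_cong[OF v]) (auto simp: refl_ext_def even_ext_def)
    have "primitive_on T (2 * T) (refl_ext (- \<epsilon>) T v) (\<lambda>t. - \<epsilon> * - (\<sigma> (2 * T - t) - q (2 * T - t) * u (2 * T - t)))"
      by (rule primitive_on_cong[OF primitive_on_cmult[OF rv, of "- \<epsilon>"]]) (simp_all add: right)
    then show "primitive_on T (2 * T) (refl_ext (- \<epsilon>) T v) (\<lambda>t. refl_ext \<epsilon> T \<sigma> t - even_ext T q t * refl_ext \<epsilon> T u t)"
      by (rule primitive_on_spike_point[where x = T]) (auto simp: refl_ext_def even_ext_def algebra_simps)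
  qed (use T in auto)
  ultimately show "hill_solution (even_ext T q) (2 * T) (refl_ext \<epsilon> T \<sigma>) (refl_ext \<epsilon> T u) (refl_ext (- \<epsilon>) T v)"
    by (simp add: hill_solution_def)
qed

lemma even_ext_absolutely_integrable:
  "T \<ge> 0 \<Longrightarrow> a absolutely_integrable_on {0..T} \<Longrightarrow> even_ext T a absolutely_integrable_on {0..2 * T}"
  unfolding even_ext_eq_refl_ext by (rule refl_ext_absolutely_integrable)

text \<open>This turns any solution that is found by other means, in particular an extended one, into an
  integral against the Green's function.\<close>

lemma nonresonant_green_represents:
  assumes S: "S > 0" and q: "q absolutely_integrable_on {0..S}" and nr: "nonresonant B q S"
    and \<sigma>: "\<sigma> absolutely_integrable_on {0..S}"
    and h: "hill_solution q S \<sigma> u v" "bdry_values B (u 0) (v 0) (u S) (v S)" and t: "t \<in> {0..S}"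
  shows "u t = integral {0..S} (\<lambda>s. green B q S t s * \<sigma> s)"
proof -
  obtain w z where w: "hill_solution q S \<sigma> w z" "bdry_values B (w 0) (z 0) (w S) (z S)"
    "\<And>t. t \<in> {0..S} \<Longrightarrow> w t = integral {0..S} (\<lambda>s. green B q S t s * \<sigma> s)"
    using is_green_solution[OF S q is_green_green[OF S q nr] \<sigma>] by blast
  show ?thesis using nonresonant_unique[OF S q nr h w(1,2) t] w(3)[OF t] by simp
qed

lemma green_section_continuous:
  assumes "S > 0" "q absolutely_integrable_on {0..S}" "nonresonant B q S" "t \<in> {0..S}"
  shows "continuous_on {0..S} (green B q S t)"
  by (rule is_green_continuous_section[OF is_green_green]) (use assms in auto)

text \<open>Both sides integrate \<open>\<sigma>\<close> to the same value: the solution on \<open>[0, T]\<close> and its extension agree at \<open>t\<close>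
  and differ by the factor \<open>\<epsilon>\<close> at \<open>2 * T - t\<close>, and the extension is represented by \<open>H\<close> because the
  doubled problem is nonresonant.\<close>

lemma green_fold:
  assumes T: "T > 0" and a: "a absolutely_integrable_on {0..T}" and r: "reflects_to B \<epsilon> B'"
    and nr: "nonresonant B a T" and nr': "nonresonant B' (even_ext T a) (2 * T)"
    and t: "t \<in> {0..T}" and s: "s \<in> {0..T}"
  defines "H \<equiv> green B' (even_ext T a) (2 * T)"
  shows "green B a T t s = H t s + \<epsilon> * H t (2 * T - s)"
    and "\<epsilon> * green B a T t s = H (2 * T - t) s + \<epsilon> * H (2 * T - t) (2 * T - s)"
proof -
  have T2: "2 * T > 0" using T by simp
  have a2: "even_ext T a absolutely_integrable_on {0..2 * T}"
    using even_ext_absolutely_integrable[OF _ a] T by simp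
  have cG: "continuous_on {0..T} (green B a T t)" by (rule green_section_continuous[OF T a nr t])
  have cH: "continuous_on {0..2 * T} (H x)" if "x \<in> {0..2 * T}" for x
    unfolding H_def by (rule green_section_continuous[OF T2 a2 nr' that])
  have cH': "continuous_on {0..T} (\<lambda>s. H x s + \<epsilon> * H x (2 * T - s))" if "x \<in> {0..2 * T}" for x
    by (intro continuous_intros continuous_on_subset[OF cH[OF that]] continuous_on_compose2[OF cH[OF that]])
      (use T in auto)
  have t': "t \<in> {0..2 * T}" "2 * T - t \<in> {0..2 * T}" using t by auto
  have rep: "integral {0..T} (\<lambda>s. green B a T t s * \<sigma> s) = integral {0..T} (\<lambda>s. (H t s + \<epsilon> * H t (2 * T - s)) * \<sigma> s)"
    "\<epsilon> * integral {0..T} (\<lambda>s. green B a T t s * \<sigma> s)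
       = integral {0..T} (\<lambda>s. (H (2 * T - t) s + \<epsilon> * H (2 * T - t) (2 * T - s)) * \<sigma> s)"
    if \<sigma>: "\<sigma> absolutely_integrable_on {0..T}" for \<sigma>
  proof -
    obtain u v where 1: "hill_solution a T \<sigma> u v" "bdry_values B (u 0) (v 0) (u T) (v T)"
      and u: "\<And>t. t \<in> {0..T} \<Longrightarrow> u t = integral {0..T} (\<lambda>s. green B a T t s * \<sigma> s)"
      using is_green_solution[OF T a is_green_green[OF T a nr] \<sigma>] by blast
    have ext: "refl_ext \<epsilon> T u x = integral {0..T} (\<lambda>s. (H x s + \<epsilon> * H x (2 * T - s)) * \<sigma> s)"
      if x: "x \<in> {0..2 * T}" for x
    proof -
      have "refl_ext \<epsilon> T u x = integral {0..2 * T} (\<lambda>s. H x s * refl_ext \<epsilon> T \<sigma> s)"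
        unfolding H_def
        using nonresonant_green_represents[OF T2 a2 nr' refl_ext_absolutely_integrable[OF _ \<sigma>]
            hill_solution_refl_ext[OF T 1 r] x] T by simp
      also have "\<dots> = integral {0..T} (\<lambda>s. (H x s + \<epsilon> * H x (2 * T - s)) * \<sigma> s)"
        using integral_refl_ext[OF _ cH[OF x] \<sigma>] T by simp
      finally show ?thesis .
    qed
    \<comment> \<open>At \<open>t = T\<close> the point \<open>2 * T - t\<close> lies in the left branch of the extension, where the factor \<open>\<epsilon>\<close> comes from the matching condition.\<close>
    have "u T = \<epsilon> * u T" using r 1(2) by (auto simp: reflects_to_def)
    then have "refl_ext \<epsilon> T u t = u t" "refl_ext \<epsilon> T u (2 * T - t) = \<epsilon> * u t"
      using t by (cases "t = T"; simp add: refl_ext_def)+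
    then show "integral {0..T} (\<lambda>s. green B a T t s * \<sigma> s) = integral {0..T} (\<lambda>s. (H t s + \<epsilon> * H t (2 * T - s)) * \<sigma> s)"
      "\<epsilon> * integral {0..T} (\<lambda>s. green B a T t s * \<sigma> s)
       = integral {0..T} (\<lambda>s. (H (2 * T - t) s + \<epsilon> * H (2 * T - t) (2 * T - s)) * \<sigma> s)"
      using ext[OF t'(1)] ext[OF t'(2)] u[OF t] by simp_all
  qed
  show "green B a T t s = H t s + \<epsilon> * H t (2 * T - s)"
    by (rule continuous_kernel_eqI[OF T cG cH'[OF t'(1)] rep(1) s])
  have "continuous_on {0..T} (\<lambda>s. \<epsilon> * green B a T t s)" by (intro continuous_intros cG)
  then show "\<epsilon> * green B a T t s = H (2 * T - t) s + \<epsilon> * H (2 * T - t) (2 * T - s)"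
    by (rule continuous_kernel_eqI[OF T _ cH'[OF t'(2)] _ s]) (use rep(2) in \<open>simp add: mult.assoc\<close>)
qed

lemma green_pair:
  assumes T: "T > 0" and a: "a absolutely_integrable_on {0..T}"
    and r: "reflects_to B 1 B'" "reflects_to C (-1) B'"
    and nr: "nonresonant B a T" "nonresonant C a T" "nonresonant B' (even_ext T a) (2 * T)"
    and ts: "t \<in> {0..T}" "s \<in> {0..T}"
  shows "green B a T t s + green C a T t s = 2 * green B' (even_ext T a) (2 * T) t s"
    and "green B a T t s - green C a T t s = 2 * green B' (even_ext T a) (2 * T) (2 * T - t) s"
  using green_fold[OF T a r(1) nr(1,3) ts] green_fold[OF T a r(2) nr(2,3) ts] by simp_all

text \<open>The solution is extended twice, with signs \<open>\<epsilon>\<close> at \<open>T\<close> and \<open>\<delta>\<close> at \<open>2 * T\<close>, and uniqueness is invoked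
  once, on \<open>[0, 4T]\<close>; the integral is then folded back in two steps.\<close>

lemma green_double_fold:
  assumes T: "T > 0" and a: "a absolutely_integrable_on {0..T}"
    and r: "reflects_to B \<epsilon> B'" "reflects_to B' \<delta> B''"
    and nr: "nonresonant B a T" and nr'': "nonresonant B'' (even_ext (2 * T) (even_ext T a)) (4 * T)"
    and t: "t \<in> {0..T}" and s: "s \<in> {0..T}"
  defines "H \<equiv> green B'' (even_ext (2 * T) (even_ext T a)) (4 * T)"
  shows "green B a T t s = (H t s + \<delta> * H t (4 * T - s)) + \<epsilon> * (H t (2 * T - s) + \<delta> * H t (2 * T + s))"
proof -
  let ?aa = "even_ext (2 * T) (even_ext T a)"
  have T2: "2 * T > 0" and T4: "4 * T > 0" and 4: "2 * (2 * T) = 4 * T" using T by auto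
  have a4: "?aa absolutely_integrable_on {0..4 * T}"
    using even_ext_absolutely_integrable[of "2 * T", OF _ even_ext_absolutely_integrable[OF _ a]] T by simp
  have t': "t \<in> {0..4 * T}" using t by auto
  have cH: "continuous_on {0..4 * T} (H t)"
    unfolding H_def by (rule green_section_continuous[OF T4 a4 nr'' t'])
  define K where "K s = H t s + \<delta> * H t (4 * T - s)" for s
  have cK: "continuous_on {0..2 * T} K" unfolding K_def
    by (intro continuous_intros continuous_on_subset[OF cH] continuous_on_compose2[OF cH]) (use T in auto)
  have cK': "continuous_on {0..T} (\<lambda>s. K s + \<epsilon> * K (2 * T - s))"
    by (intro continuous_intros continuous_on_subset[OF cK] continuous_on_compose2[OF cK]) (use T in auto)
  have "green B a T t s = K s + \<epsilon> * K (2 * T - s)"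
  proof (rule continuous_kernel_eqI[OF T green_section_continuous[OF T a nr t] cK' _ s])
    fix \<sigma> :: "real \<Rightarrow> real" assume \<sigma>: "\<sigma> absolutely_integrable_on {0..T}"
    have \<sigma>2: "refl_ext \<epsilon> T \<sigma> absolutely_integrable_on {0..2 * T}"
      using refl_ext_absolutely_integrable[OF _ \<sigma>] T by simp
    have \<sigma>4: "refl_ext \<delta> (2 * T) (refl_ext \<epsilon> T \<sigma>) absolutely_integrable_on {0..4 * T}"
      using refl_ext_absolutely_integrable[OF _ \<sigma>2] T by simp
    obtain u v where 1: "hill_solution a T \<sigma> u v" "bdry_values B (u 0) (v 0) (u T) (v T)"
      and u: "\<And>t. t \<in> {0..T} \<Longrightarrow> u t = integral {0..T} (\<lambda>s. green B a T t s * \<sigma> s)"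
      using is_green_solution[OF T a is_green_green[OF T a nr] \<sigma>] by blast
    note 2 = hill_solution_refl_ext[OF T2 hill_solution_refl_ext[OF T 1 r(1)] r(2), unfolded 4]
    have "u t = refl_ext \<delta> (2 * T) (refl_ext \<epsilon> T u) t" using t by (simp add: refl_ext_def)
    also have "\<dots> = integral {0..4 * T} (\<lambda>s. H t s * refl_ext \<delta> (2 * T) (refl_ext \<epsilon> T \<sigma>) s)"
      unfolding H_def by (rule nonresonant_green_represents[OF T4 a4 nr'' \<sigma>4 2 t'])
    also have "\<dots> = integral {0..2 * T} (\<lambda>s. K s * refl_ext \<epsilon> T \<sigma> s)"
      using integral_refl_ext[of "2 * T" "H t" "refl_ext \<epsilon> T \<sigma>" \<delta>] cH \<sigma>2 T by (simp add: K_def)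
    also have "\<dots> = integral {0..T} (\<lambda>s. (K s + \<epsilon> * K (2 * T - s)) * \<sigma> s)"
      using integral_refl_ext[OF _ cK \<sigma>] T by simp
    finally show "integral {0..T} (\<lambda>s. green B a T t s * \<sigma> s) = integral {0..T} (\<lambda>s. (K s + \<epsilon> * K (2 * T - s)) * \<sigma> s)"
      using u[OF t] by simp
  qed
  then show ?thesis by (simp add: K_def)
qed

text \<open>The sign pairs \<open>(\<epsilon>, \<delta>)\<close> are \<open>(1, 1)\<close> for Neumann, \<open>(-1, -1)\<close> for Dirichlet, \<open>(-1, 1)\<close> for the
  first and \<open>(1, -1)\<close> for the second mixed condition. The intermediate condition on \<open>[0, 2T]\<close> is
  Neumann or Dirichlet according to the condition at \<open>0\<close>.\<close>

lemma green_quadruple: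
  assumes T: "T > 0" and a: "a absolutely_integrable_on {0..T}"
    and nr: "nonresonant Neumann a T" "nonresonant Dirichlet a T" "nonresonant Mixed1 a T" "nonresonant Mixed2 a T"
    and nr4: "nonresonant Periodic (even_ext (2 * T) (even_ext T a)) (4 * T)"
    and ts: "t \<in> {0..T}" "s \<in> {0..T}"
  shows "green Neumann a T t s + green Dirichlet a T t s + green Mixed1 a T t s + green Mixed2 a T t s
      = 4 * green Periodic (even_ext (2 * T) (even_ext T a)) (4 * T) t s"
proof -
  note R = reflects_to_table
  show ?thesis
    using green_double_fold[OF T a R(5) R(1) nr(1) nr4 ts] green_double_fold[OF T a R(8) R(2) nr(2) nr4 ts]
      green_double_fold[OF T a R(6) R(1) nr(3) nr4 ts] green_double_fold[OF T a R(7) R(2) nr(4) nr4 ts]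
    by simp
qed

theorem mainTheorem4:
  fixes T :: real and a :: "real \<Rightarrow> real"
  assumes "T > 0" and "a absolutely_integrable_on {0..T}"
  shows
    "(nonresonant Neumann a T \<and> nonresonant Dirichlet a T \<and>
      nonresonant Periodic (even_ext T a) (2 * T) \<longrightarrow>
        (\<forall>t\<in>{0..T}. \<forall>s\<in>{0..T}.
           green Neumann a T t s + green Dirichlet a T t s
             = 2 * green Periodic (even_ext T a) (2 * T) t s \<and>
           green Neumann a T t s - green Dirichlet a T t s
             = 2 * green Periodic (even_ext T a) (2 * T) (2 * T - t) s)) \<and>
     (nonresonant Mixed2 a T \<and> nonresonant Mixed1 a T \<and>
      nonresonant Antiperiodic (even_ext T a) (2 * T) \<longrightarrow>
        (\<forall>t\<in>{0..T}. \<forall>s\<in>{0..T}.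
           green Mixed2 a T t s + green Mixed1 a T t s
             = 2 * green Antiperiodic (even_ext T a) (2 * T) t s \<and>
           green Mixed2 a T t s - green Mixed1 a T t s
             = 2 * green Antiperiodic (even_ext T a) (2 * T) (2 * T - t) s)) \<and>
     (nonresonant Neumann a T \<and> nonresonant Mixed1 a T \<and>
      nonresonant Neumann (even_ext T a) (2 * T) \<longrightarrow>
        (\<forall>t\<in>{0..T}. \<forall>s\<in>{0..T}.
           green Neumann a T t s + green Mixed1 a T t s
             = 2 * green Neumann (even_ext T a) (2 * T) t s \<and>
           green Neumann a T t s - green Mixed1 a T t s
             = 2 * green Neumann (even_ext T a) (2 * T) (2 * T - t) s)) \<and>
     (nonresonant Mixed2 a T \<and> nonresonant Dirichlet a T \<and>
      nonresonant Dirichlet (even_ext T a) (2 * T) \<longrightarrow>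
        (\<forall>t\<in>{0..T}. \<forall>s\<in>{0..T}.
           green Mixed2 a T t s + green Dirichlet a T t s
             = 2 * green Dirichlet (even_ext T a) (2 * T) t s \<and>
           green Mixed2 a T t s - green Dirichlet a T t s
             = 2 * green Dirichlet (even_ext T a) (2 * T) (2 * T - t) s)) \<and>
     (nonresonant Neumann a T \<and> nonresonant Dirichlet a T \<and>
      nonresonant Mixed1 a T \<and> nonresonant Mixed2 a T \<and>
      nonresonant Periodic (even_ext (2 * T) (even_ext T a)) (4 * T) \<longrightarrow>
        (\<forall>t\<in>{0..T}. \<forall>s\<in>{0..T}.
           green Neumann a T t s + green Dirichlet a T t s
             + green Mixed1 a T t s + green Mixed2 a T t s
             = 4 * green Periodic (even_ext (2 * T) (even_ext T a)) (4 * T) t s))"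
proof -
  note pair = green_pair[OF assms] and R = reflects_to_table
  show ?thesis
    by (intro conjI impI ballI; elim conjE)
      (rule pair[OF R(1,2)] pair[OF R(3,4)] pair[OF R(5,6)] pair[OF R(7,8)] green_quadruple[OF assms]; assumption)+
qed

end
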